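(* Let $\mathbf{Y}\in\mathbb{R}^{I\times I\times 2}$. (a) If there exists a nonsingular $\mathbf{U}\in\mathbb{R}^{2\times 2}$ such that $\mathbf{X}=(\mathbf{I}_I,\mathbf{I}_I,\mathbf{U})\cdot\mathbf{Y}$ has nonsingular first slice $\mathbf{X}_1$, then: (a1) $\mathbf{Y}$ is an interior point of $\mathcal{S}_I(I,I,2)$ if $\mathbf{X}_2\mathbf{X}_1^{-1}$ has $I$ distinct real eigenvalues; (a2) $\mathbf{Y}$ is a boundary point of $\mathcal{S}_I(I,I,2)$ if $\mathbf{X}_2\mathbf{X}_1^{-1}$ has $I$ real eigenvalues (counted with algebraic multiplicity) but not all distinct; (a3) $\mathbf{Y}$ is an exterior point of $\mathcal{S}_I(I,I,2)$ if $\mathbf{X}_2\mathbf{X}_1^{-1}$ has at least one pair of complex (non-real) eigenvalues. (b) If there does not exist a nonsingular $\mathbf{U}\in\mathbb{R}^{2\times 2}$ such that $\mathbf{X}=(\mathbf{I}_I,\mathbf{I}_I,\mathbf{U})\cdot\mathbf{Y}$ has nonsingular first slice $\mathbf{X}_1$, then $\mathbf{Y}$ is a boundary point of $\mathcal{S}_I(I,I,2)$.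
   Context: All arrays and matrices are real. $\circ$ denotes the outer product of vectors. For $\mathbf{Y}\in\mathbb{R}^{I\times J\times K}$ the outer-product rank is $\mathrm{rank}_\circ(\mathbf{Y})=\min\{R \mid \mathbf{Y}=\sum_{r=1}^R \mathbf{x}_r\circ\mathbf{y}_r\circ\mathbf{z}_r\}$ with $\mathbf{x}_r\in\mathbb{R}^I$, $\mathbf{y}_r\in\mathbb{R}^J$, $\mathbf{z}_r\in\mathbb{R}^K$ (the zero array has rank $0$). Let $\mathcal{S}_R(I,J,K)=\{\mathbf{Y}\in\mathbb{R}^{I\times J\times K}\mid \mathrm{rank}_\circ(\mathbf{Y})\le R\}$. Interior, boundary and exterior points of this set are understood in the usual (Frobenius norm) topology of $\mathbb{R}^{I\times J\times K}$; exterior points are the points not in the closure of the set. For an $I\times J\times 2$ array $\mathbf{Y}$, $\mathbf{Y}_k$ ($k=1,2$) denotes the $k$th frontal slice, the $I\times J$ matrix with entries $y_{ijk}$. $(\mathbf{S},\mathbf{T},\mathbf{U})\cdot\mathbf{Y}$ denotes multilinear matrix multiplication of $\mathbf{Y}$ by matrices $\mathbf{S},\mathbf{T},\mathbf{U}$ in the three modes; in particular, for $\mathbf{U}=(u_{kl})\in\mathbb{R}^{2\times 2}$, $\mathbf{X}=(\mathbf{I}_I,\mathbf{I}_I,\mathbf{U})\cdot\mathbf{Y}$ is the $I\times I\times 2$ array with slices $\mathbf{X}_k=u_{k1}\mathbf{Y}_1+u_{k2}\mathbf{Y}_2$, $k=1,2$.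
   Formalization: Part (b) is stated only for I ≥ 2: for I = 1 it is false, since the only array without a suitable U is Y = 0, and every 1×1×2 array has rank at most 1, so Y = 0 is an interior point of S_1(1,1,2). *)

theory Defs
  imports "HOL-Analysis.Analysis" "HOL-Computational_Algebra.Polynomial"
begin

text \<open>
  An \<open>I \<times> J \<times> K\<close> array is an element \<open>Y\<close> of \<open>real^'k^'j^'i\<close>, with entries \<open>Y $ i $ j $ k\<close>.
  The library norm on this type is the iterated Euclidean norm, i.e. the Frobenius norm, so
  \<open>interior\<close>, \<open>closure\<close> and \<open>frontier\<close> refer to the Frobenius topology.
\<close>

definition outer3 :: "real^'i \<Rightarrow> real^'j \<Rightarrow> real^'k \<Rightarrow> real^'k^'j^'i" where
  "outer3 x y z = (\<chi> i j k. x $ i * y $ j * z $ k)"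

definition outer_rank :: "real^'k^'j^'i \<Rightarrow> nat" where
  "outer_rank Y = (LEAST R. \<exists>x y z. Y = (\<Sum>r<R. outer3 (x r) (y r) (z r)))"

definition rank_le_set :: "nat \<Rightarrow> (real^'k^'j^'i) set" where
  "rank_le_set R = {Y. outer_rank Y \<le> R}"

text \<open>The set over which the minimum is taken is never empty, so \<open>LEAST\<close> is a genuine minimum.\<close>

lemma outer_rank_attained:
  fixes Y :: "real^'k^'j^'i"
  shows "\<exists>x y z. Y = (\<Sum>r<outer_rank Y. outer3 (x r) (y r) (z r))"
proof -
  obtain f :: "nat \<Rightarrow> 'i \<times> 'j \<times> 'k" where f: "bij_betw f {..<card (UNIV :: ('i \<times> 'j \<times> 'k) set)} UNIV"
    using ex_bij_betw_nat_finite[of "UNIV :: ('i \<times> 'j \<times> 'k) set"] by (auto simp: atLeast0LessThan)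
  define g where "g = (\<lambda>(a, b, c). outer3 (axis a 1) (axis b 1) (axis c (Y $ a $ b $ c)) :: real^'k^'j^'i)"
  have "Y = (\<Sum>p\<in>UNIV. g p)"
  proof (simp add: vec_eq_iff, intro allI)
    fix i j k
    have "(\<Sum>p\<in>UNIV. g p $ i $ j $ k) = (\<Sum>p\<in>UNIV. if p = (i, j, k) then Y $ i $ j $ k else 0)"
      by (intro sum.cong) (auto simp: g_def outer3_def axis_def split: if_splits)
    then show "Y $ i $ j $ k = (\<Sum>p\<in>UNIV. g p $ i $ j $ k)" by simp
  qed
  also have "\<dots> = (\<Sum>r<card (UNIV :: ('i \<times> 'j \<times> 'k) set). g (f r))"
    by (rule sum.reindex_bij_betw[OF f, symmetric])
  finally have Y: "Y = (\<Sum>r<card (UNIV :: ('i \<times> 'j \<times> 'k) set). g (f r))" .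
  define u :: "nat \<Rightarrow> real^'i" where "u = (\<lambda>r. axis (fst (f r)) 1)"
  define v :: "nat \<Rightarrow> real^'j" where "v = (\<lambda>r. axis (fst (snd (f r))) 1)"
  define w :: "nat \<Rightarrow> real^'k" where
    "w = (\<lambda>r. axis (snd (snd (f r))) (Y $ fst (f r) $ fst (snd (f r)) $ snd (snd (f r))))"
  have "g (f r) = outer3 (u r) (v r) (w r)" for r
    by (simp add: g_def u_def v_def w_def case_prod_unfold)
  with Y have "Y = (\<Sum>r<card (UNIV :: ('i \<times> 'j \<times> 'k) set). outer3 (u r) (v r) (w r))"
    by simp
  then have "\<exists>(R::nat) x y z. Y = (\<Sum>r<R. outer3 (x r) (y r) (z r))"
    by blast
  then show ?thesis unfolding outer_rank_def by (rule LeastI_ex)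
qed

definition frontal_slice :: "real^'k^'j^'i \<Rightarrow> 'k \<Rightarrow> real^'j^'i" where
  "frontal_slice Y k = (\<chi> i j. Y $ i $ j $ k)"

definition multilinear_mult ::
    "real^'i^'i2 \<Rightarrow> real^'j^'j2 \<Rightarrow> real^'k^'k2 \<Rightarrow> real^'k^'j^'i \<Rightarrow> real^'k2^'j2^'i2" where
  "multilinear_mult S T U Y =
     (\<chi> i j k. \<Sum>i'\<in>UNIV. \<Sum>j'\<in>UNIV. \<Sum>k'\<in>UNIV.
        S $ i $ i' * T $ j $ j' * U $ k $ k' * Y $ i' $ j' $ k')"

lemma frontal_slice_mode3_mult:
  fixes Y :: "real^2^'j^'i" and U :: "real^2^2"
  shows "frontal_slice (multilinear_mult (mat 1) (mat 1) U Y) k =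
         U $ k $ 1 *\<^sub>R frontal_slice Y 1 + U $ k $ 2 *\<^sub>R frontal_slice Y 2"
proof -
  have "multilinear_mult (mat 1) (mat 1) U Y $ i $ j $ k =
        U $ k $ 1 * Y $ i $ j $ 1 + U $ k $ 2 * Y $ i $ j $ 2" for i j
  proof -
    have "multilinear_mult (mat 1) (mat 1) U Y $ i $ j $ k =
        (\<Sum>i'\<in>UNIV. if i = i' then \<Sum>j'\<in>UNIV. if j = j' then
          U $ k $ 1 * Y $ i' $ j' $ 1 + U $ k $ 2 * Y $ i' $ j' $ 2 else 0 else 0)"
      unfolding multilinear_mult_def vec_lambda_beta sum_2
    proof (rule sum.cong[OF refl])
      fix i'
      have "(\<Sum>j'\<in>UNIV. mat 1 $ i $ i' * mat 1 $ j $ j' * U $ k $ 1 * Y $ i' $ j' $ 1 +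
                mat 1 $ i $ i' * mat 1 $ j $ j' * U $ k $ 2 * Y $ i' $ j' $ 2) =
            (\<Sum>j'\<in>UNIV. if i = i' \<and> j = j' then
                U $ k $ 1 * Y $ i' $ j' $ 1 + U $ k $ 2 * Y $ i' $ j' $ 2 else 0)"
        by (rule sum.cong) (auto simp: mat_def)
      then show "(\<Sum>j'\<in>UNIV. mat 1 $ i $ i' * mat 1 $ j $ j' * U $ k $ 1 * Y $ i' $ j' $ 1 +
                mat 1 $ i $ i' * mat 1 $ j $ j' * U $ k $ 2 * Y $ i' $ j' $ 2) =
            (if i = i' then \<Sum>j'\<in>UNIV. if j = j' then
                U $ k $ 1 * Y $ i' $ j' $ 1 + U $ k $ 2 * Y $ i' $ j' $ 2 else 0 else 0)"
        by simp
    qed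
    then show ?thesis by simp
  qed
  then show ?thesis by (simp add: vec_eq_iff frontal_slice_def)
qed

definition eigvals :: "'a::field^'n^'n \<Rightarrow> 'a set" where
  "eigvals A = {c. \<exists>v. v \<noteq> 0 \<and> A *v v = c *s v}"

text \<open>\<open>char_polynomial A\<close> is the determinant of \<open>X I - A\<close>, computed over the polynomial ring.\<close>

definition char_polynomial :: "'a::field^'n^'n \<Rightarrow> 'a poly" where
  "char_polynomial A = det (\<chi> i j. (if i = j then [:0, 1:] else 0) - [:A $ i $ j:])"

definition alg_mult :: "'a::field^'n^'n \<Rightarrow> 'a \<Rightarrow> nat" where
  "alg_mult A c = order c (char_polynomial A)"

definition complexify :: "real^'n^'m \<Rightarrow> complex^'n^'m" where
  "complexify A = (\<chi> i j. complex_of_real (A $ i $ j))"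

end

theory Submission
  imports Defs
begin

text \<open>
  An array with slices \<open>A\<close>, \<open>B\<close> has rank at most \<open>n\<close> exactly when \<open>A = X D W\<close> and \<open>B = X E W\<close> with
  diagonal \<open>D\<close>, \<open>E\<close> (\<open>pencil_in_rank_le_iff\<close>). Such a pair has
  \<open>det (B - t A) = det X det W \<Prod>\<^sub>i (e\<^sub>i - t d\<^sub>i)\<close>, so all its generalized eigenvalues are real, and conversely
  \<open>n\<close> distinct real roots of \<open>det (B - t A)\<close> with \<open>A\<close> invertible yield a basis of eigenvectors and thus such
  a factorization (\<open>simultaneous_diagonalization\<close>). Mixing the slices by a nonsingular \<open>U\<close>, and multiplying
  both slices by fixed invertible matrices, are linear bijections that preserve the rank, hence also
  interior and closure (\<open>slice_mixing_iff\<close>, \<open>strict_equivalence_iff\<close>).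

  Regular pencils, that is with \<open>A\<close> invertible. If there are \<open>n\<close> distinct real roots then
  \<open>det (B - t A)\<close> changes sign at each of them; sign changes survive small perturbations, so nearby arrays
  have \<open>n\<close> distinct real roots as well (\<open>distinct_roots_imp_interior\<close>). If \<open>c\<close> is a nonreal root, then
  the closed inequality \<open>\<bar>det A\<bar> \<bar>Im c\<bar>\<^sup>n \<le> \<bar>det (B - c A)\<bar>\<close>, which holds on all arrays of rank at most \<open>n\<close>,
  fails, so the array is exterior (\<open>nonreal_root_imp_not_closure\<close>). If there are fewer than \<open>n\<close> roots,
  the array is not interior: should it have rank at most \<open>n\<close>, two roots of the factorization coincide
  and an off-diagonal entry creates a nontrivial Jordan block, which cannot be diagonalized
  (\<open>repeated_root_imp_not_interior\<close>). If the characteristic polynomial of \<open>B A\<^sup>-\<^sup>1\<close> splits over the reals, the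
  matrix is triangular in a suitable basis and its diagonal can be made distinct by small perturbations,
  so the array is in the closure (\<open>splitting_char_polynomial_imp_closure\<close>).

  Singular pencils, that is with \<open>det (\<alpha> A + \<beta> B) = 0\<close> for all \<open>\<alpha>\<close>, \<open>\<beta>\<close>. The frontier is closed, so one may
  perturb inside the singular pencils until the kernel of \<open>A\<close> is a line, and then normalize
  \<open>A = I - a a\<^sup>T\<close> with a unit vector \<open>a\<close>. For every parameter \<open>t\<close> the matrix \<open>B - t A\<close> has a right null vector
  and a left null vector. After a further perturbation these null vectors fill so much of the space that one
  can choose \<open>n - 1\<close> parameters \<open>t\<^sub>i\<close>, a vector \<open>v\<close> orthogonal to the right null vectors at some of them and a
  vector \<open>u\<close> orthogonal to the left null vectors at the others. The perturbation
  \<open>B - t A + \<epsilon> (t - \<tau>) u v\<^sup>T\<close> is then regular with roots exactly \<open>t\<^sub>1, \<dots>, t\<^sub>n\<^sub>-\<^sub>1, \<tau>\<close>, where \<open>\<tau>\<close> is free. A new value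
  of \<open>\<tau>\<close> gives \<open>n\<close> distinct real roots, hence rank at most \<open>n\<close>; taking \<open>\<tau>\<close> among the \<open>t\<^sub>i\<close> leaves a
  repeated root, hence an array that is not interior. Letting \<open>\<epsilon>\<close> tend to zero, the singular
  pencil is a limit of both kinds (\<open>frontier_if_many_nodes\<close>).
\<close>

section \<open>Pencils and simultaneous diagonal factorizations\<close>

definition pencil :: "real^'n^'n \<Rightarrow> real^'n^'n \<Rightarrow> real^2^'n^'n" where
  "pencil A B = (\<chi> i j k. if k = 1 then A $ i $ j else B $ i $ j)"

lemma frontal_slice_pencil [simp]:
  "frontal_slice (pencil A B) 1 = A" "frontal_slice (pencil A B) 2 = B"
  by (simp_all add: frontal_slice_def pencil_def vec_eq_iff)

lemma pencil_frontal_slices: "pencil (frontal_slice Y 1) (frontal_slice Y 2) = Y"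
proof -
  have "k = 1 \<or> k = 2" for k :: 2 by (rule exhaust_2)
  then show ?thesis by (auto simp: frontal_slice_def pencil_def vec_eq_iff)
qed

definition diag :: "('n \<Rightarrow> 'a::zero) \<Rightarrow> 'a^'n^'n" where
  "diag d = (\<chi> i j. if i = j then d i else 0)"

lemma det_diag: "det (diag d :: 'a::comm_ring_1^'n^'n) = (\<Prod>i\<in>UNIV. d i)"
  by (subst det_diagonal) (auto simp: diag_def)

lemma matrix_diag_matrix_nth:
  "(X ** diag d ** W) $ i $ j = (\<Sum>r\<in>UNIV. X $ i $ r * d r * W $ r $ j)"
  for X :: "'a::comm_semiring_1^'n^'m"
proof -
  have "(X ** diag d) $ i $ r = X $ i $ r * d r" for r
  proof -
    have "(X ** diag d) $ i $ r = (\<Sum>k\<in>UNIV. if k = r then X $ i $ k * d k else 0)"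
      unfolding matrix_matrix_mult_def vec_lambda_beta by (rule sum.cong) (auto simp: diag_def)
    then show ?thesis by simp
  qed
  then show ?thesis by (simp add: matrix_matrix_mult_def)
qed

lemma diag_mult_vec_nth: "(diag d *v x) $ i = d i * x $ i"
  for d :: "'n::finite \<Rightarrow> 'a::comm_semiring_1"
proof -
  have "(diag d *v x) $ i = (\<Sum>k\<in>UNIV. if i = k then d k * x $ k else 0)"
    unfolding matrix_vector_mult_def vec_lambda_beta by (rule sum.cong) (auto simp: diag_def)
  then show ?thesis by simp
qed

lemma matrix_diag_add:
  "X ** diag d ** W + c *\<^sub>R (X ** diag e ** W) = X ** diag (\<lambda>i. d i + c * e i) ** W"
  for X W :: "real^'n^'n"
  unfolding vec_eq_iff
  by (simp add: matrix_diag_matrix_nth sum_distrib_left flip: sum.distrib)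
    (simp add: algebra_simps)

text \<open>
  Padding with zero terms makes the number of terms exactly the dimension, so that the terms can be
  indexed by the same finite type as the coordinates.
\<close>
lemma rank_le_iff_card_terms:
  fixes Z :: "real^2^'n^'n"
  shows "Z \<in> rank_le_set CARD('n) \<longleftrightarrow>
    (\<exists>x y z :: 'n \<Rightarrow> _. Z = (\<Sum>r\<in>UNIV. outer3 (x r) (y r) (z r)))"
proof
  obtain f :: "nat \<Rightarrow> 'n" where f: "bij_betw f {..<CARD('n)} UNIV"
    using ex_bij_betw_nat_finite[of "UNIV :: 'n set"] by (auto simp: atLeast0LessThan)
  {
    assume "Z \<in> rank_le_set CARD('n)"
    then have le: "outer_rank Z \<le> CARD('n)" by (simp add: rank_le_set_def)
    obtain x y z where Z: "Z = (\<Sum>r<outer_rank Z. outer3 (x r) (y r) (z r))"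
      using outer_rank_attained[of Z] by blast
    define x' where "x' r = (if r < outer_rank Z then x r else 0)" for r
    have "outer3 (x' r) (y r) (z r) = (if r < outer_rank Z then outer3 (x r) (y r) (z r) else 0)" for r
      by (simp add: x'_def outer3_def vec_eq_iff)
    moreover have "{..<CARD('n)} \<inter> {r. r < outer_rank Z} = {..<outer_rank Z}" using le by auto
    ultimately have "Z = (\<Sum>r<CARD('n). outer3 (x' r) (y r) (z r))"
      by (subst Z) (simp add: sum.If_cases)
    also have "\<dots> = (\<Sum>r<CARD('n). (\<lambda>i. outer3 (x' (inv_into {..<CARD('n)} f i))
        (y (inv_into {..<CARD('n)} f i)) (z (inv_into {..<CARD('n)} f i))) (f r))"
      by (rule sum.cong) (use f in \<open>auto simp: bij_betw_def\<close>)
    also have "\<dots> = (\<Sum>i\<in>UNIV. outer3 (x' (inv_into {..<CARD('n)} f i))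
        (y (inv_into {..<CARD('n)} f i)) (z (inv_into {..<CARD('n)} f i)))"
      by (rule sum.reindex_bij_betw[OF f])
    finally show "\<exists>x y z :: 'n \<Rightarrow> _. Z = (\<Sum>r\<in>UNIV. outer3 (x r) (y r) (z r))"
      by (intro exI[of _ "\<lambda>i. x' (inv_into {..<CARD('n)} f i)"]
          exI[of _ "\<lambda>i. y (inv_into {..<CARD('n)} f i)"] exI[of _ "\<lambda>i. z (inv_into {..<CARD('n)} f i)"])
  next
    assume "\<exists>x y z :: 'n \<Rightarrow> _. Z = (\<Sum>r\<in>UNIV. outer3 (x r) (y r) (z r))"
    then obtain x y z :: "'n \<Rightarrow> _" where "Z = (\<Sum>r\<in>UNIV. outer3 (x r) (y r) (z r))" by blast
    also have "\<dots> = (\<Sum>r<CARD('n). outer3 (x (f r)) (y (f r)) (z (f r)))"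
      by (rule sum.reindex_bij_betw[OF f, symmetric])
    finally have "outer_rank Z \<le> CARD('n)"
      unfolding outer_rank_def
      by (intro Least_le exI[of _ "\<lambda>r. x (f r)"] exI[of _ "\<lambda>r. y (f r)"] exI[of _ "\<lambda>r. z (f r)"])
    then show "Z \<in> rank_le_set CARD('n)" by (simp add: rank_le_set_def)
  }
qed

text \<open>
  The vectors in the first two modes of a rank-one decomposition are the columns of \<open>X\<close> and the
  rows of \<open>W\<close>; the two coordinates in the third mode are the diagonals.
\<close>
lemma pencil_in_rank_le_iff:
  fixes A B :: "real^'n^'n"
  shows "pencil A B \<in> rank_le_set CARD('n) \<longleftrightarrow>
    (\<exists>(X :: real^'n^'n) W d e. A = X ** diag d ** W \<and> B = X ** diag e ** W)"
proof
  assume "pencil A B \<in> rank_le_set CARD('n)"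
  then obtain x y z :: "'n \<Rightarrow> _" where eq: "pencil A B = (\<Sum>r\<in>UNIV. outer3 (x r) (y r) (z r))"
    by (auto simp: rank_le_iff_card_terms)
  define X :: "real^'n^'n" where "X = (\<chi> i r. x r $ i)"
  define W :: "real^'n^'n" where "W = (\<chi> r j. y r $ j)"
  have *: "pencil A B $ i $ j $ k = (X ** diag (\<lambda>r. z r $ k) ** W) $ i $ j" for i j k
    unfolding eq matrix_diag_matrix_nth by (simp add: outer3_def X_def W_def ac_simps)
  have "A = X ** diag (\<lambda>r. z r $ 1) ** W"
    by (simp add: vec_eq_iff flip: *) (simp add: pencil_def)
  moreover have "B = X ** diag (\<lambda>r. z r $ 2) ** W"
    by (simp add: vec_eq_iff flip: *) (simp add: pencil_def)
  ultimately show "\<exists>(X :: real^'n^'n) W d e. A = X ** diag d ** W \<and> B = X ** diag e ** W" by blast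
next
  assume "\<exists>(X :: real^'n^'n) W d e. A = X ** diag d ** W \<and> B = X ** diag e ** W"
  then obtain X W :: "real^'n^'n" and d e
    where AB: "A = X ** diag d ** W" "B = X ** diag e ** W" by blast
  have "pencil A B = (\<Sum>r\<in>UNIV. outer3 (\<chi> i. X $ i $ r) (W $ r) (\<chi> k. if k = 1 then d r else e r))"
    unfolding AB by (auto simp: vec_eq_iff pencil_def outer3_def matrix_diag_matrix_nth ac_simps intro!: sum.cong)
  then show "pencil A B \<in> rank_le_set CARD('n)" unfolding rank_le_iff_card_terms
    by (intro exI[of _ "\<lambda>r. \<chi> i. X $ i $ r"] exI[of _ "\<lambda>r. W $ r"]
        exI[of _ "\<lambda>r. \<chi> k. if k = 1 then d r else e r"])
qed

lemma matrix_inv_inverse: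
  fixes A :: "real^'n^'n"
  assumes "invertible A"
  shows "A ** matrix_inv A = mat 1" "matrix_inv A ** A = mat 1"
  using someI_ex[OF assms[unfolded invertible_def]] by (simp_all add: matrix_inv_def)

lemma det_eq_0_iff_kernel: "det A = 0 \<longleftrightarrow> (\<exists>x. x \<noteq> 0 \<and> A *v x = 0)" for A :: "'a::field^'n^'n"
proof -
  have "det A \<noteq> 0 \<longleftrightarrow> (\<forall>x. A *v x = 0 \<longrightarrow> x = 0)"
    unfolding invertible_det_nz[symmetric] invertible_left_inverse matrix_left_invertible_ker ..
  then show ?thesis by blast
qed

lemma det_eq_0_iff_left_kernel: "det A = 0 \<longleftrightarrow> (\<exists>x. x \<noteq> 0 \<and> x v* A = 0)" for A :: "real^'n^'n"
  using det_eq_0_iff_kernel[of "transpose A"] by simp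

lemma invertible_kernel_0: "invertible A \<Longrightarrow> A *v x = 0 \<longleftrightarrow> x = 0" for A :: "real^'n^'n"
  unfolding invertible_left_inverse matrix_left_invertible_ker by auto

lemma invertibleI_kernel: "(\<And>x. A *v x = 0 \<Longrightarrow> x = 0) \<Longrightarrow> invertible A" for A :: "real^'n^'n"
  unfolding invertible_left_inverse matrix_left_invertible_ker by blast

lemma pencil_mult_vec: "(B - t *\<^sub>R A) *v x = B *v x - t *\<^sub>R (A *v x)" for A B :: "real^'n^'m"
  by (simp add: matrix_vector_mult_diff_rdistrib scaleR_matrix_vector_assoc)

lemma matrix_vec_sum_scaleR:
  "A *v (\<Sum>i\<in>I. c i *\<^sub>R b i) = (\<Sum>i\<in>I. c i *\<^sub>R (A *v b i))" for A :: "real^'n^'m"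
  by (simp add: linear_sum[OF matrix_vector_mul_linear] o_def matrix_vector_mult_scaleR)

section \<open>Eigenvectors of a regular pencil\<close>

text \<open>
  The usual induction for eigenvectors: \<open>B - s A\<close> kills the term of \<open>s\<close> and multiplies the others by
  nonzero scalars, up to the injective matrix \<open>A\<close>.
\<close>
lemma generalized_eigenvectors_independent:
  fixes A B :: "real^'n^'n"
  assumes A: "invertible A" and fin: "finite \<Lambda>"
    and eig: "\<And>t. t \<in> \<Lambda> \<Longrightarrow> b t \<noteq> 0 \<and> B *v b t = t *\<^sub>R (A *v b t)"
    and "(\<Sum>t\<in>\<Lambda>. c t *\<^sub>R b t) = 0"
  shows "\<forall>t\<in>\<Lambda>. c t = 0"
  using fin eig \<open>(\<Sum>t\<in>\<Lambda>. c t *\<^sub>R b t) = 0\<close>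
proof (induction \<Lambda> arbitrary: c)
  case (insert s \<Lambda>)
  have "(B - s *\<^sub>R A) *v (\<Sum>t\<in>insert s \<Lambda>. c t *\<^sub>R b t)
      = (\<Sum>t\<in>insert s \<Lambda>. c t *\<^sub>R ((t - s) *\<^sub>R (A *v b t)))"
    unfolding matrix_vec_sum_scaleR
    by (rule sum.cong) (use insert.prems(1) in \<open>auto simp: pencil_mult_vec scaleR_diff_left\<close>)
  also have "\<dots> = A *v (\<Sum>t\<in>\<Lambda>. (c t * (t - s)) *\<^sub>R b t)"
    using insert.hyps by (simp add: matrix_vec_sum_scaleR)
  finally have "A *v (\<Sum>t\<in>\<Lambda>. (c t * (t - s)) *\<^sub>R b t) = 0"
    unfolding insert.prems(2) by simp
  then have "(\<Sum>t\<in>\<Lambda>. (c t * (t - s)) *\<^sub>R b t) = 0"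
    using invertible_kernel_0[OF A] by simp
  then have "\<forall>t\<in>\<Lambda>. c t * (t - s) = 0"
    using insert.prems(1) by (intro insert.IH) auto
  then have 0: "\<forall>t\<in>\<Lambda>. c t = 0" using insert.hyps by auto
  then have "c s *\<^sub>R b s = 0" using insert.prems(2) insert.hyps by simp
  then show ?case using 0 insert.prems(1)[of s] by auto
qed simp

text \<open>
  The subspace \<open>W\<close> is arbitrary because the bound is applied both to the whole space and to
  invariant subspaces.
\<close>
lemma card_generalized_eigenvalues_le_dim:
  fixes A B :: "real^'n^'n"
  assumes A: "invertible A" and fin: "finite \<Lambda>"
    and eig: "\<And>t. t \<in> \<Lambda> \<Longrightarrow> \<exists>v\<in>W. v \<noteq> 0 \<and> B *v v = t *\<^sub>R (A *v v)"
  shows "card \<Lambda> \<le> dim W"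
proof -
  have "\<forall>t\<in>\<Lambda>. \<exists>v. v \<in> W \<and> v \<noteq> 0 \<and> B *v v = t *\<^sub>R (A *v v)"
    using eig by blast
  from bchoice[OF this] obtain b
    where b: "\<And>t. t \<in> \<Lambda> \<Longrightarrow> b t \<in> W \<and> b t \<noteq> 0 \<and> B *v b t = t *\<^sub>R (A *v b t)"
    by blast
  have inj: "inj_on b \<Lambda>"
  proof
    fix s t assume st: "s \<in> \<Lambda>" "t \<in> \<Lambda>" "b s = b t"
    then have "s *\<^sub>R (A *v b t) = t *\<^sub>R (A *v b t)" using b by metis
    moreover have "A *v b t \<noteq> 0" using invertible_kernel_0[OF A] b st by blast
    ultimately show "s = t" by simp
  qed
  have "independent (b ` \<Lambda>)"
  proof
    assume "dependent (b ` \<Lambda>)"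
    then obtain u where u: "(\<Sum>v\<in>b ` \<Lambda>. u v *\<^sub>R v) = 0" "\<exists>v\<in>b ` \<Lambda>. u v \<noteq> 0"
      using fin by (auto simp: dependent_finite)
    have "(\<Sum>t\<in>\<Lambda>. u (b t) *\<^sub>R b t) = 0"
      using u(1) by (simp add: sum.reindex[OF inj])
    then have "\<forall>t\<in>\<Lambda>. u (b t) = 0"
      using b by (intro generalized_eigenvectors_independent[OF A fin, where B = B]) auto
    then show False using u(2) by auto
  qed
  then have "card (b ` \<Lambda>) \<le> dim W"
    using b by (intro independent_card_le_dim) auto
  then show ?thesis by (simp add: card_image[OF inj])
qed

lemma det_pencil_eq_0_iff:
  "det (B - t *\<^sub>R A) = 0 \<longleftrightarrow> (\<exists>v. v \<noteq> 0 \<and> B *v v = t *\<^sub>R (A *v v))" for A B :: "real^'n^'n"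
  by (simp add: det_eq_0_iff_kernel pencil_mult_vec)

lemma card_pencil_roots_le:
  fixes A B :: "real^'n^'n"
  assumes "invertible A" "finite \<Lambda>" "\<And>t. t \<in> \<Lambda> \<Longrightarrow> det (B - t *\<^sub>R A) = 0"
  shows "card \<Lambda> \<le> CARD('n)"
  using card_generalized_eigenvalues_le_dim[OF assms(1,2), of UNIV B] assms(3)
  by (simp add: det_pencil_eq_0_iff)

lemma finite_pencil_roots:
  fixes A B :: "real^'n^'n"
  assumes "invertible A"
  shows "finite {t. det (B - t *\<^sub>R A) = 0}"
proof (rule ccontr)
  assume "infinite {t. det (B - t *\<^sub>R A) = 0}"
  then obtain T where "finite T" "card T = Suc CARD('n)" "T \<subseteq> {t. det (B - t *\<^sub>R A) = 0}"
    by (meson infinite_arbitrarily_large)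
  then show False using card_pencil_roots_le[OF assms, of T B] by auto
qed

text \<open>
  With \<open>V\<close> the matrix of the \<open>n\<close> independent eigenvectors, \<open>B V = A V diag \<mu>\<close>; so \<open>X = A V\<close> and
  \<open>W = V\<^sup>-\<^sup>1\<close> work.
\<close>
lemma simultaneous_diagonalization:
  fixes A B :: "real^'n^'n"
  assumes A: "invertible A" and inj: "inj (\<mu> :: 'n \<Rightarrow> real)" and root: "\<And>i. det (B - \<mu> i *\<^sub>R A) = 0"
  obtains X W where "invertible X" "invertible W"
    "A = X ** diag (\<lambda>_. 1) ** W" "B = X ** diag \<mu> ** W"
proof -
  have "\<forall>i. \<exists>v. v \<noteq> 0 \<and> B *v v = \<mu> i *\<^sub>R (A *v v)"
    using root unfolding det_pencil_eq_0_iff by blast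
  from choice[OF this] obtain v where v: "\<And>i. v i \<noteq> 0 \<and> B *v v i = \<mu> i *\<^sub>R (A *v v i)"
    by blast
  define V :: "real^'n^'n" where "V = (\<chi> i j. v j $ i)"
  have Vx: "V *v x = (\<Sum>j\<in>UNIV. x $ j *\<^sub>R v j)" for x
    by (simp add: V_def vec_eq_iff matrix_vector_mult_def mult.commute)
  have V: "invertible V"
  proof (rule invertibleI_kernel)
    fix x assume "V *v x = 0"
    then have "(\<Sum>j\<in>UNIV. x $ j *\<^sub>R v j) = 0" using Vx by metis
    then have "(\<Sum>t\<in>range \<mu>. (x $ inv \<mu> t) *\<^sub>R v (inv \<mu> t)) = 0"
      using inj by (simp add: sum.reindex)
    then have "\<forall>t\<in>range \<mu>. x $ inv \<mu> t = 0"
      using v inj by (intro generalized_eigenvectors_independent[OF A, where B = B]) auto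
    then show "x = 0" using inj by (auto simp: vec_eq_iff)
  qed
  define W where "W = matrix_inv V"
  have W: "V ** W = mat 1" "W ** V = mat 1"
    using matrix_inv_inverse[OF V] by (simp_all add: W_def)
  have "B ** V = A ** V ** diag \<mu>"
  proof -
    have "column j (B ** V) = column j (A ** V ** diag \<mu>)" for j
    proof -
      have Vj: "V *v axis j 1 = v j" by (simp add: Vx axis_def if_distrib[of "\<lambda>x. x *\<^sub>R _"] cong: if_cong)
      have d: "diag \<mu> *v axis j 1 = \<mu> j *\<^sub>R (axis j 1 :: real^'n)"
        by (simp add: vec_eq_iff diag_mult_vec_nth axis_def)
      have "(B ** V) *v axis j 1 = (A ** V ** diag \<mu>) *v axis j 1"
        by (simp add: d Vj v matrix_vector_mult_scaleR flip: matrix_vector_mul_assoc)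
      then show ?thesis by (simp add: matrix_vector_mult_basis)
    qed
    then show ?thesis by (simp add: column_def vec_eq_iff)
  qed
  then have "B = A ** V ** diag \<mu> ** W"
    by (metis W(1) matrix_mul_assoc matrix_mul_rid)
  moreover have "A = A ** V ** diag (\<lambda>_. 1) ** W"
  proof -
    have "diag (\<lambda>_. 1) = (mat 1 :: real^'n^'n)" by (simp add: diag_def mat_def)
    then show ?thesis by (metis W(1) matrix_mul_assoc matrix_mul_rid)
  qed
  moreover have "invertible (A ** V)" using A V by (rule invertible_mult)
  moreover have "invertible W" using W by (auto simp: invertible_def)
  ultimately show ?thesis using that by blast
qed

lemma inj_enumeration:
  assumes "finite \<Lambda>" "CARD('n) \<le> card \<Lambda>"
  obtains f :: "'n::finite \<Rightarrow> 'a" where "inj f" "range f \<subseteq> \<Lambda>"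
  using card_le_inj[of "UNIV :: 'n set" \<Lambda>] assms by auto

lemma distinct_roots_imp_rank_le:
  fixes A B :: "real^'n^'n"
  assumes "invertible A" "finite \<Lambda>" "CARD('n) \<le> card \<Lambda>" "\<And>t. t \<in> \<Lambda> \<Longrightarrow> det (B - t *\<^sub>R A) = 0"
  shows "pencil A B \<in> rank_le_set CARD('n)"
proof -
  obtain \<mu> :: "'n \<Rightarrow> real" where "inj \<mu>" "range \<mu> \<subseteq> \<Lambda>" by (rule inj_enumeration[OF assms(2,3)])
  have "\<And>i. det (B - \<mu> i *\<^sub>R A) = 0" using \<open>range \<mu> \<subseteq> \<Lambda>\<close> assms(4) by auto
  from simultaneous_diagonalization[OF assms(1) \<open>inj \<mu>\<close> this]
  obtain X W where "A = X ** diag (\<lambda>_. 1) ** W" "B = X ** diag \<mu> ** W" by metis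
  then show ?thesis unfolding pencil_in_rank_le_iff by blast
qed

section \<open>Regular pencils with distinct real, repeated or nonreal eigenvalues\<close>

lemma continuous_on_det [continuous_intros]:
  fixes f :: "'a::topological_space \<Rightarrow> 'b::real_normed_field^'n^'n"
  shows "continuous_on S f \<Longrightarrow> continuous_on S (\<lambda>x. det (f x))"
  unfolding det_def by (intro continuous_intros)

lemma continuous_on_frontal_slice [continuous_intros]:
  "continuous_on S f \<Longrightarrow> continuous_on S (\<lambda>x. frontal_slice (f x) k)"
  unfolding frontal_slice_def by (intro continuous_intros)

lemma continuous_on_pencil [continuous_intros]:
  assumes "continuous_on S f" "continuous_on S g"
  shows "continuous_on S (\<lambda>x. pencil (f x) (g x))"
  unfolding pencil_def
proof (intro continuous_on_vec_lambda)
  fix i j k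
  show "continuous_on S (\<lambda>x. if k = (1 :: 2) then f x $ i $ j else g x $ i $ j)"
    using assms by (cases "k = 1") (auto intro!: continuous_intros)
qed

lemma eventually_at_right_0_imp_ex:
  assumes "\<forall>\<^sub>F \<epsilon> in at_right (0::real). P \<epsilon>"
  shows "\<exists>\<epsilon>>0. P \<epsilon>"
proof -
  have "\<forall>\<^sub>F \<epsilon> in at_right 0. 0 < \<epsilon> \<and> P \<epsilon>"
    using assms eventually_at_right_less[of 0] by (rule eventually_conj[rotated])
  then show ?thesis
    by (rule eventually_happens'[OF trivial_limit_at_right_real])
qed

text \<open>
  The product of the values of \<open>det (B - t A)\<close> at \<open>\<mu> i - \<delta>\<close> and \<open>\<mu> i + \<delta>\<close> is negative when \<open>\<delta>\<close> is less than
  half of all gaps between the \<open>\<mu> i\<close>. These finitely many inequalities define an open set of arrays, in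
  which the intermediate value theorem gives one root near each \<open>\<mu> i\<close>.
\<close>
lemma distinct_roots_imp_interior:
  fixes A B :: "real^'n^'n"
  assumes A: "invertible A" and inj: "inj (\<mu> :: 'n \<Rightarrow> real)" and root: "\<And>i. det (B - \<mu> i *\<^sub>R A) = 0"
  shows "pencil A B \<in> interior (rank_le_set CARD('n))"
proof -
  obtain X W where XW: "A = X ** diag (\<lambda>_. 1) ** W" "B = X ** diag \<mu> ** W"
    using simultaneous_diagonalization[OF A inj root] by metis
  define \<phi> where "\<phi> Z t = det (frontal_slice Z 2 - t *\<^sub>R frontal_slice Z 1)" for Z :: "real^2^'n^'n" and t
  define c where "c = det X * det W"
  have "c \<noteq> 0"
    using A by (simp add: c_def XW invertible_det_nz det_mul)
  have \<phi>_AB: "\<phi> (pencil A B) t = c * (\<Prod>i\<in>UNIV. \<mu> i - t)" for t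
  proof -
    have "B - t *\<^sub>R A = X ** diag (\<lambda>i. \<mu> i + (- t) * 1) ** W"
      using matrix_diag_add[of X \<mu> W "-t" "\<lambda>_. 1"] by (simp add: XW)
    then show ?thesis by (simp add: \<phi>_def det_mul det_diag c_def)
  qed
  have "\<forall>\<^sub>F \<delta> in at_right 0. \<forall>i j. i \<noteq> j \<longrightarrow> 2 * \<delta> < \<bar>\<mu> i - \<mu> j\<bar>"
  proof (intro eventually_all_finite)
    fix i j
    show "\<forall>\<^sub>F \<delta> in at_right 0. i \<noteq> j \<longrightarrow> 2 * \<delta> < \<bar>\<mu> i - \<mu> j\<bar>"
    proof (cases "i = j")
      case False
      then have "0 < \<bar>\<mu> i - \<mu> j\<bar> / 2" using inj by (auto dest: injD)
      then show ?thesis by (intro eventually_at_rightI[of 0 "\<bar>\<mu> i - \<mu> j\<bar> / 2"]) auto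
    qed simp
  qed
  from eventually_at_right_0_imp_ex[OF this]
  obtain \<delta> where \<delta>: "0 < \<delta>" "\<And>i j. i \<noteq> j \<Longrightarrow> 2 * \<delta> < \<bar>\<mu> i - \<mu> j\<bar>" by blast
  have sign: "\<phi> (pencil A B) (\<mu> i - \<delta>) * \<phi> (pencil A B) (\<mu> i + \<delta>) < 0" for i
  proof -
    have "\<phi> (pencil A B) (\<mu> i - \<delta>) * \<phi> (pencil A B) (\<mu> i + \<delta>)
        = c\<^sup>2 * (\<Prod>j\<in>UNIV. (\<mu> j - \<mu> i)\<^sup>2 - \<delta>\<^sup>2)"
      unfolding \<phi>_AB by (simp add: power2_eq_square algebra_simps flip: prod.distrib)
    also have "(\<Prod>j\<in>UNIV. (\<mu> j - \<mu> i)\<^sup>2 - \<delta>\<^sup>2) = - \<delta>\<^sup>2 * (\<Prod>j\<in>UNIV - {i}. (\<mu> j - \<mu> i)\<^sup>2 - \<delta>\<^sup>2)"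
      by (subst prod.remove[of _ i]) auto
    finally have eq: "\<phi> (pencil A B) (\<mu> i - \<delta>) * \<phi> (pencil A B) (\<mu> i + \<delta>)
        = - (c\<^sup>2 * \<delta>\<^sup>2 * (\<Prod>j\<in>UNIV - {i}. (\<mu> j - \<mu> i)\<^sup>2 - \<delta>\<^sup>2))" by simp
    have "0 < (\<Prod>j\<in>UNIV - {i}. (\<mu> j - \<mu> i)\<^sup>2 - \<delta>\<^sup>2)"
    proof (rule prod_pos)
      fix j assume "j \<in> UNIV - {i}"
      then have "\<delta> < \<bar>\<mu> j - \<mu> i\<bar>" using \<delta>(2)[of j i] \<delta>(1) by auto
      then have "\<delta>\<^sup>2 < \<bar>\<mu> j - \<mu> i\<bar>\<^sup>2" using \<delta>(1) by (intro power_strict_mono) auto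
      then show "0 < (\<mu> j - \<mu> i)\<^sup>2 - \<delta>\<^sup>2" by simp
    qed
    then show ?thesis using \<open>c \<noteq> 0\<close> \<delta>(1) unfolding eq by simp
  qed
  define N where "N = {Z :: real^2^'n^'n. det (frontal_slice Z 1) \<noteq> 0} \<inter>
      (\<Inter>i. {Z. \<phi> Z (\<mu> i - \<delta>) * \<phi> Z (\<mu> i + \<delta>) < 0})"
  have cont: "continuous_on UNIV (\<lambda>Z. \<phi> Z t)" for t
    unfolding \<phi>_def by (intro continuous_intros)
  have "open N"
    unfolding N_def
    by (intro open_Int open_INT ballI open_Collect_neq open_Collect_less continuous_intros cont) auto
  moreover have "pencil A B \<in> N"
    using sign A by (auto simp: N_def invertible_det_nz)
  moreover have "N \<subseteq> rank_le_set CARD('n)"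
  proof
    fix Z assume Z: "Z \<in> N"
    have cont_t: "continuous_on T (\<lambda>t. \<phi> Z t)" for T
      unfolding \<phi>_def by (intro continuous_intros)
    have "\<exists>t. \<mu> i - \<delta> \<le> t \<and> t \<le> \<mu> i + \<delta> \<and> \<phi> Z t = 0" for i
    proof -
      have "\<phi> Z (\<mu> i - \<delta>) * \<phi> Z (\<mu> i + \<delta>) < 0" using Z by (auto simp: N_def)
      then consider "\<phi> Z (\<mu> i - \<delta>) \<le> 0" "0 \<le> \<phi> Z (\<mu> i + \<delta>)"
        | "0 \<le> \<phi> Z (\<mu> i - \<delta>)" "\<phi> Z (\<mu> i + \<delta>) \<le> 0"
        by (auto simp: mult_less_0_iff)
      then show ?thesis
        using IVT'[of "\<phi> Z" "\<mu> i - \<delta>" 0 "\<mu> i + \<delta>"] IVT2'[of "\<phi> Z" "\<mu> i + \<delta>" 0 "\<mu> i - \<delta>"]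
          cont_t \<delta>(1) by cases auto
    qed
    then obtain \<nu> where \<nu>: "\<And>i. \<mu> i - \<delta> \<le> \<nu> i \<and> \<nu> i \<le> \<mu> i + \<delta> \<and> \<phi> Z (\<nu> i) = 0" by metis
    have "inj \<nu>"
    proof
      fix i j assume "\<nu> i = \<nu> j"
      then have "\<bar>\<mu> i - \<mu> j\<bar> \<le> 2 * \<delta>" using \<nu>[of i] \<nu>[of j] by auto
      then show "i = j" using \<delta>(2)[of i j] by force
    qed
    then have "pencil (frontal_slice Z 1) (frontal_slice Z 2) \<in> rank_le_set CARD('n)"
      using Z \<nu> by (intro distinct_roots_imp_rank_le[where \<Lambda> = "range \<nu>"])
        (auto simp: card_image N_def invertible_det_nz \<phi>_def)
    then show "Z \<in> rank_le_set CARD('n)" by (simp add: pencil_frontal_slices)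
  qed
  ultimately show ?thesis by (rule interiorI)
qed

definition complex_pencil :: "complex \<Rightarrow> real^'n^'n \<Rightarrow> real^'n^'n \<Rightarrow> complex^'n^'n" where
  "complex_pencil c A B = (\<chi> i j. complex_of_real (B $ i $ j) - c * complex_of_real (A $ i $ j))"

lemma det_complexify: "det (complexify A) = complex_of_real (det A)"
  by (simp add: det_def complexify_def)

text \<open>
  Both sides factor over the diagonals, and \<open>\<bar>e - c d\<bar> \<ge> \<bar>Im c\<bar> \<bar>d\<bar>\<close> for real \<open>d\<close> and \<open>e\<close>. Stated without any
  inverse, the bound is a closed condition on the array.
\<close>
lemma rank_le_imp_det_complex_pencil_bound:
  fixes A B :: "real^'n^'n"
  assumes "pencil A B \<in> rank_le_set CARD('n)"
  shows "\<bar>det A\<bar> * \<bar>Im c\<bar> ^ CARD('n) \<le> norm (det (complex_pencil c A B))"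
proof -
  obtain X W :: "real^'n^'n" and d e where XW: "A = X ** diag d ** W" "B = X ** diag e ** W"
    using assms pencil_in_rank_le_iff by blast
  have "complex_pencil c A B
      = complexify X ** diag (\<lambda>i. complex_of_real (e i) - c * complex_of_real (d i)) ** complexify W"
    by (simp add: vec_eq_iff complex_pencil_def XW matrix_diag_matrix_nth complexify_def
        sum_distrib_left algebra_simps flip: sum_subtractf)
  then have "norm (det (complex_pencil c A B))
      = \<bar>det X\<bar> * (\<Prod>i\<in>UNIV. norm (complex_of_real (e i) - c * complex_of_real (d i))) * \<bar>det W\<bar>"
    by (simp add: det_mul det_diag det_complexify norm_mult prod_norm[symmetric])
  also have "\<dots> \<ge> \<bar>det X\<bar> * (\<Prod>i\<in>UNIV. \<bar>d i\<bar> * \<bar>Im c\<bar>) * \<bar>det W\<bar>"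
  proof (intro mult_right_mono mult_left_mono prod_mono conjI)
    fix i
    have "\<bar>Im (complex_of_real (e i) - c * complex_of_real (d i))\<bar>
        \<le> norm (complex_of_real (e i) - c * complex_of_real (d i))" by (rule abs_Im_le_cmod)
    then show "\<bar>d i\<bar> * \<bar>Im c\<bar> \<le> norm (complex_of_real (e i) - c * complex_of_real (d i))"
      by (simp add: abs_mult mult.commute)
  qed auto
  also have "\<bar>det X\<bar> * (\<Prod>i\<in>UNIV. \<bar>d i\<bar> * \<bar>Im c\<bar>) * \<bar>det W\<bar> = \<bar>det A\<bar> * \<bar>Im c\<bar> ^ CARD('n)"
    by (simp add: XW det_mul det_diag prod.distrib abs_mult abs_prod)
  finally show ?thesis .
qed

lemma nonreal_root_imp_not_closure:
  fixes A B :: "real^'n^'n"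
  assumes A: "invertible A" and c: "c \<notin> \<real>" "det (complex_pencil c A B) = 0"
  shows "pencil A B \<notin> closure (rank_le_set CARD('n))"
proof
  define S where "S = {Z :: real^2^'n^'n. \<bar>det (frontal_slice Z 1)\<bar> * \<bar>Im c\<bar> ^ CARD('n)
      \<le> norm (det (complex_pencil c (frontal_slice Z 1) (frontal_slice Z 2)))}"
  assume "pencil A B \<in> closure (rank_le_set CARD('n))"
  moreover have "closure (rank_le_set CARD('n)) \<subseteq> S"
  proof (rule closure_minimal)
    show "rank_le_set CARD('n) \<subseteq> S"
    proof
      fix Z :: "real^2^'n^'n" assume "Z \<in> rank_le_set CARD('n)"
      then show "Z \<in> S"
        using rank_le_imp_det_complex_pencil_bound[of "frontal_slice Z 1" "frontal_slice Z 2" c]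
        by (simp add: S_def pencil_frontal_slices)
    qed
    show "closed S"
      unfolding S_def complex_pencil_def by (intro closed_Collect_le continuous_intros)
  qed
  ultimately have le: "\<bar>det A\<bar> * \<bar>Im c\<bar> ^ CARD('n) \<le> 0" using c by (auto simp: S_def)
  have "det A \<noteq> 0" "Im c \<noteq> 0"
    using A c by (auto simp: invertible_det_nz complex_is_Real_iff)
  then have "0 < \<bar>det A\<bar> * \<bar>Im c\<bar> ^ CARD('n)" by simp
  then show False using le by simp
qed

lemma complexify_matrix_mul: "complexify (A ** B) = complexify A ** complexify B"
  by (simp add: complexify_def matrix_matrix_mult_def vec_eq_iff)

lemma nonreal_eigenvalue_imp_root:
  fixes A B :: "real^'n^'n"
  assumes A: "invertible A" and c: "c \<in> eigvals (complexify (B ** matrix_inv A))"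
  shows "det (complex_pencil c A B) = 0"
proof -
  let ?M = "complexify (B ** matrix_inv A)"
  obtain v where v: "v \<noteq> 0" "?M *v v = c *s v" using c by (auto simp: eigvals_def)
  have "mat c *v v = c *s v"
    by (simp add: vec_eq_iff matrix_vector_mult_def mat_def if_distrib[of "\<lambda>x. x * _"] cong: if_cong)
  then have "(?M - mat c) *v v = 0"
    using v(2) by (simp add: matrix_vector_mult_diff_rdistrib)
  then have "det (?M - mat c) = 0" using v(1) det_eq_0_iff_kernel by blast
  moreover have "complex_pencil c A B = (?M - mat c) ** complexify A"
  proof -
    have "B = B ** matrix_inv A ** A"
      by (metis A matrix_inv_inverse(2) matrix_mul_assoc matrix_mul_rid)
    then have "complexify B = ?M ** complexify A" by (metis complexify_matrix_mul)
    moreover have "(mat c ** complexify A) $ i $ j = c * complexify A $ i $ j" for i j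
      by (simp add: matrix_matrix_mult_def mat_def if_distrib[of "\<lambda>x. x * _"] cong: if_cong)
    moreover have "(?M - mat c) ** complexify A = ?M ** complexify A - mat c ** complexify A"
      by (simp add: vec_eq_iff matrix_matrix_mult_def left_diff_distrib sum_subtractf)
    ultimately show ?thesis
      by (simp add: vec_eq_iff complex_pencil_def) (simp add: complexify_def)
  qed
  ultimately show ?thesis by (simp add: det_mul)
qed

text \<open>
  Perturbation arguments run along one-parameter families \<open>f \<epsilon>\<close> with \<open>\<epsilon> > 0\<close>; this is their form of continuity
  at the unperturbed point.
\<close>
lemma open_meets_perturbation:
  fixes f :: "real \<Rightarrow> 'a::topological_space"
  assumes "continuous_on UNIV f" "open S" "f 0 \<in> S"
  shows "\<forall>\<^sub>F \<epsilon> in at_right 0. f \<epsilon> \<in> S"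
proof -
  have "(f \<longlongrightarrow> f 0) (at 0)" using assms(1) by (simp add: continuous_on_def)
  then have "(f \<longlongrightarrow> f 0) (at_right 0)" by (rule filterlim_mono) (auto intro: at_le)
  then show ?thesis using assms(2,3) topological_tendstoD by blast
qed

text \<open>
  In a factorization \<open>A = X D W\<close>, \<open>B = X E W\<close> two ratios \<open>e\<^sub>i / d\<^sub>i = t\<close> must coincide. Adding \<open>\<epsilon>\<close> at position
  \<open>(i, j)\<close> of \<open>E\<close> makes \<open>N = B - t A\<close> satisfy \<open>N A\<^sup>-\<^sup>1 N w = 0\<close> but \<open>N w \<noteq> 0\<close> for some \<open>w\<close>. In a diagonal
  factorization the first equation would force the second expression to vanish, so the perturbed
  arrays have rank greater than \<open>n\<close>.
\<close>
lemma repeated_root_imp_not_interior: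
  fixes A B :: "real^'n^'n"
  assumes A: "invertible A" and few: "card {t. det (B - t *\<^sub>R A) = 0} < CARD('n)"
  shows "pencil A B \<notin> interior (rank_le_set CARD('n))"
proof
  assume int: "pencil A B \<in> interior (rank_le_set CARD('n))"
  then have "pencil A B \<in> rank_le_set CARD('n)" using interior_subset by blast
  then obtain X W :: "real^'n^'n" and d e where XW: "A = X ** diag d ** W" "B = X ** diag e ** W"
    using pencil_in_rank_le_iff by blast
  have nz: "det X \<noteq> 0" "det W \<noteq> 0" "\<And>i. d i \<noteq> 0"
    using A by (auto simp: XW invertible_det_nz det_mul det_diag)
  have sub: "B - t *\<^sub>R A = X ** diag (\<lambda>i. e i - t * d i) ** W" for t
    using matrix_diag_add[of X e W "-t" d] by (simp add: XW)
  have "det (B - (e i / d i) *\<^sub>R A) = 0" for i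
    unfolding sub using nz by (auto simp: det_mul det_diag intro!: exI[of _ i])
  then have "range (\<lambda>i. e i / d i) \<subseteq> {t. det (B - t *\<^sub>R A) = 0}" by auto
  then have "card (range (\<lambda>i. e i / d i)) < CARD('n)"
    using few card_mono[OF finite_pencil_roots[OF A, of B]] le_less_trans by blast
  then have "\<not> inj (\<lambda>i. e i / d i)"
    using card_image[of "\<lambda>i. e i / d i" UNIV] by auto
  then obtain i j where ij: "i \<noteq> j" "e i / d i = e j / d j" by (auto simp: inj_def)
  define t where "t = e i / d i"
  have t: "e i - t * d i = 0" "e j - t * d j = 0" 
    using nz(3)[of i] nz(3)[of j] ij(2) by (simp_all add: t_def field_simps)
  define E :: "real^'n^'n" where "E = (\<chi> k l. if k = i \<and> l = j then 1 else 0)"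
  have Ev: "E *v x = x $ j *\<^sub>R axis i 1" for x
  proof -
    have "(E *v x) $ k = (\<Sum>l\<in>UNIV. if l = j then (if k = i then x $ j else 0) else 0)" for k
      unfolding matrix_vector_mult_def vec_lambda_beta E_def by (rule sum.cong) auto
    then show ?thesis by (simp add: vec_eq_iff axis_def)
  qed
  have "\<forall>\<^sub>F \<epsilon> in at_right 0. pencil A (B + \<epsilon> *\<^sub>R (X ** E ** W)) \<in> interior (rank_le_set CARD('n))"
    by (rule open_meets_perturbation) (use int in \<open>auto intro!: continuous_intros\<close>)
  from eventually_at_right_0_imp_ex[OF this]
  obtain \<epsilon> where \<epsilon>: "\<epsilon> > 0" "pencil A (B + \<epsilon> *\<^sub>R (X ** E ** W)) \<in> rank_le_set CARD('n)"
    using interior_subset by blast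
  then obtain X' W' :: "real^'n^'n" and d' e' where
    XW': "A = X' ** diag d' ** W'" "B + \<epsilon> *\<^sub>R (X ** E ** W) = X' ** diag e' ** W'"
    using pencil_in_rank_le_iff by blast
  have nz': "det X' \<noteq> 0" "det W' \<noteq> 0"
    using A by (auto simp: XW'(1) invertible_det_nz det_mul)
  define N where "N = B + \<epsilon> *\<^sub>R (X ** E ** W) - t *\<^sub>R A"
  have N': "N = X' ** diag (\<lambda>i. e' i - t * d' i) ** W'"
    using matrix_diag_add[of X' e' W' "-t" d'] by (simp add: XW' N_def)
  have Nv: "N *v y = X *v (diag (\<lambda>i. e i - t * d i) *v (W *v y) + \<epsilon> *\<^sub>R (E *v (W *v y)))" for y
  proof -
    have "N = X ** diag (\<lambda>i. e i - t * d i) ** W + \<epsilon> *\<^sub>R (X ** E ** W)"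
      using sub[of t] by (simp add: N_def algebra_simps)
    then show ?thesis
      by (simp add: matrix_vector_mult_add_rdistrib matrix_vector_right_distrib
          matrix_vector_mult_scaleR flip: matrix_vector_mul_assoc scaleR_matrix_vector_assoc)
  qed
  have "invertible W" using nz(2) by (simp add: invertible_det_nz)
  \<comment> \<open>\<open>h = A\<^sup>-\<^sup>1 N w\<close>, written out in the basis given by \<open>W\<close>\<close>
  define w where "w = matrix_inv W *v axis j 1"
  define h where "h = matrix_inv W *v ((\<epsilon> / d i) *\<^sub>R axis i 1)"
  have Ww: "W *v w = axis j 1" and Wh: "W *v h = (\<epsilon> / d i) *\<^sub>R axis i 1"
    by (simp_all add: w_def h_def matrix_vector_mul_assoc matrix_inv_inverse[OF \<open>invertible W\<close>])
  have "diag (\<lambda>i. e i - t * d i) *v axis j 1 = 0" "diag (\<lambda>i. e i - t * d i) *v axis i 1 = 0"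
    using t by (auto simp: vec_eq_iff diag_mult_vec_nth axis_def)
  then have Nw: "N *v w = X *v (\<epsilon> *\<^sub>R axis i 1)" and Nh: "N *v h = 0"
    using ij(1) by (simp_all add: Nv Ww Wh Ev matrix_vector_mult_scaleR) (simp_all add: axis_def)
  have "diag d *v axis i 1 = d i *\<^sub>R axis i 1" by (simp add: vec_eq_iff diag_mult_vec_nth axis_def)
  then have Ah: "A *v h = N *v w"
    using nz(3)[of i] by (simp add: XW(1) Nw Wh matrix_vector_mult_scaleR flip: matrix_vector_mul_assoc)
  have cancel: "X' *v x = X' *v y \<longleftrightarrow> x = y" for x y
    using nz'(1) invertible_kernel_0[of X' "x - y"]
    by (simp add: invertible_det_nz matrix_vector_mult_diff_distrib)
  have "diag d' *v (W' *v h) = diag (\<lambda>i. e' i - t * d' i) *v (W' *v w)"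
    using Ah unfolding N' XW'(1) by (simp add: cancel flip: matrix_vector_mul_assoc)
  then have 1: "d' k * (W' *v h) $ k = (e' k - t * d' k) * (W' *v w) $ k" for k
    by (simp add: vec_eq_iff diag_mult_vec_nth)
  have "diag (\<lambda>i. e' i - t * d' i) *v (W' *v h) = 0"
    using Nh cancel[of _ 0] unfolding N' by (simp flip: matrix_vector_mul_assoc)
  then have 2: "(e' k - t * d' k) * (W' *v h) $ k = 0" for k
    by (simp add: vec_eq_iff diag_mult_vec_nth)
  have "(e' k - t * d' k) * (W' *v w) $ k = 0" for k
    using 1[of k] 2[of k] by auto
  then have "diag (\<lambda>i. e' i - t * d' i) *v (W' *v w) = 0" by (simp add: vec_eq_iff diag_mult_vec_nth)
  then have "N *v w = 0" unfolding N' by (simp flip: matrix_vector_mul_assoc)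
  then have "X *v (\<epsilon> *\<^sub>R axis i 1) = 0" using Nw by simp
  then have "\<epsilon> *\<^sub>R axis i (1::real) = (0 :: real^'n)"
    using nz(1) invertible_kernel_0[of X] by (simp add: invertible_det_nz)
  then show False using \<epsilon>(1) by (simp add: axis_eq_0_iff)
qed

section \<open>Symmetries of the set of arrays of small rank\<close>

lemma invariant_under_linear_bijection:
  fixes T T' :: "'a::euclidean_space \<Rightarrow> 'a"
  assumes "linear T" "\<And>x. T' (T x) = x" "\<And>x. T (T' x) = x"
    and "\<And>x. x \<in> S \<Longrightarrow> T x \<in> S" "\<And>x. x \<in> S \<Longrightarrow> T' x \<in> S"
  shows "T x \<in> closure S \<longleftrightarrow> x \<in> closure S" "T x \<in> interior S \<longleftrightarrow> x \<in> interior S"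
proof -
  have inj: "inj T" by (metis assms(2) injI)
  have "T ` S = S" using assms(3-5) by (auto simp: image_iff) metis
  then have "T ` closure S = closure S" "T ` interior S = interior S"
    using closure_injective_linear_image[OF assms(1) inj, of S]
      interior_injective_linear_image[OF assms(1) inj, of S] by simp_all
  then show "T x \<in> closure S \<longleftrightarrow> x \<in> closure S" "T x \<in> interior S \<longleftrightarrow> x \<in> interior S"
    using inj_image_mem_iff[OF inj] by metis+
qed

lemma pencil_add: "pencil (A + A') (B + B') = pencil A B + pencil A' B'"
  by (simp add: pencil_def vec_eq_iff)

lemma pencil_scaleR: "pencil (c *\<^sub>R A) (c *\<^sub>R B) = c *\<^sub>R pencil A B"
  by (simp add: pencil_def vec_eq_iff)

lemma frontal_slice_add: "frontal_slice (Y + Z) k = frontal_slice Y k + frontal_slice Z k"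
  by (simp add: frontal_slice_def vec_eq_iff)

lemma frontal_slice_scaleR: "frontal_slice (c *\<^sub>R Y) k = c *\<^sub>R frontal_slice Y k"
  by (simp add: frontal_slice_def vec_eq_iff)

lemma matrix_add_mult_distrib: "(A + B) ** C = A ** C + B ** C" for A B :: "real^'n^'m"
  by (simp add: vec_eq_iff matrix_matrix_mult_def distrib_right sum.distrib)

lemma rank_le_equivalence:
  fixes G H A B :: "real^'n^'n"
  assumes "pencil A B \<in> rank_le_set CARD('n)"
  shows "pencil (G ** A ** H) (G ** B ** H) \<in> rank_le_set CARD('n)"
proof -
  obtain X W :: "real^'n^'n" and d e where "A = X ** diag d ** W" "B = X ** diag e ** W"
    using assms pencil_in_rank_le_iff by blast
  then have "G ** A ** H = (G ** X) ** diag d ** (W ** H)" "G ** B ** H = (G ** X) ** diag e ** (W ** H)"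
    by (simp_all add: matrix_mul_assoc)
  then show ?thesis unfolding pencil_in_rank_le_iff by blast
qed

lemma strict_equivalence_iff:
  fixes G H A B :: "real^'n^'n"
  assumes "invertible G" "invertible H"
  shows "pencil (G ** A ** H) (G ** B ** H) \<in> closure (rank_le_set CARD('n))
      \<longleftrightarrow> pencil A B \<in> closure (rank_le_set CARD('n))" (is ?cl)
    and "pencil (G ** A ** H) (G ** B ** H) \<in> interior (rank_le_set CARD('n))
      \<longleftrightarrow> pencil A B \<in> interior (rank_le_set CARD('n))" (is ?int)
proof -
  define T where "T G H Y = pencil (G ** frontal_slice Y 1 ** H) (G ** frontal_slice Y 2 ** H)"
    for G H :: "real^'n^'n" and Y :: "real^2^'n^'n"
  have lin: "linear (T G H)" for G H
  proof (rule linearI)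
    show "T G H (Y + Z) = T G H Y + T G H Z" for Y Z
      by (simp add: T_def frontal_slice_add matrix_add_ldistrib matrix_add_mult_distrib flip: pencil_add)
    show "T G H (c *\<^sub>R Y) = c *\<^sub>R T G H Y" for c Y
      by (simp add: T_def frontal_slice_scaleR matrix_scalar_ac flip: pencil_scaleR scalar_matrix_assoc)
  qed
  have inv: "T (matrix_inv G) (matrix_inv H) (T G H Y) = Y" if "invertible G" "invertible H" for G H Y
  proof -
    have "matrix_inv G ** (G ** M ** H) ** matrix_inv H = (matrix_inv G ** G) ** M ** (H ** matrix_inv H)" for M
      by (simp add: matrix_mul_assoc)
    then show ?thesis using that by (simp add: T_def matrix_inv_inverse pencil_frontal_slices)
  qed
  have inv': "T G H (T (matrix_inv G) (matrix_inv H) Y) = Y" for Y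
  proof -
    have "G ** (matrix_inv G ** M ** matrix_inv H) ** H = (G ** matrix_inv G) ** M ** (matrix_inv H ** H)" for M
      by (simp add: matrix_mul_assoc)
    then show ?thesis using assms by (simp add: T_def matrix_inv_inverse pencil_frontal_slices)
  qed
  have mem: "T G H Y \<in> rank_le_set CARD('n)" if "Y \<in> rank_le_set CARD('n)" for G H Y
    unfolding T_def by (rule rank_le_equivalence) (simp add: pencil_frontal_slices that)
  show ?cl ?int
    using invariant_under_linear_bijection[OF lin inv[OF assms] inv' mem mem, of "pencil A B"]
    by (simp_all add: T_def)
qed

lemma mix_slices_eq:
  fixes Y :: "real^2^'n^'n"
  shows "multilinear_mult (mat 1) (mat 1) U Y = pencil
    (U $ 1 $ 1 *\<^sub>R frontal_slice Y 1 + U $ 1 $ 2 *\<^sub>R frontal_slice Y 2)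
    (U $ 2 $ 1 *\<^sub>R frontal_slice Y 1 + U $ 2 $ 2 *\<^sub>R frontal_slice Y 2)"
  by (subst pencil_frontal_slices[symmetric]) (simp add: frontal_slice_mode3_mult)

lemma slice_mixing_iff:
  fixes Y :: "real^2^'n^'n" and U :: "real^2^2"
  assumes U: "invertible U"
  shows "multilinear_mult (mat 1) (mat 1) U Y \<in> closure (rank_le_set CARD('n))
      \<longleftrightarrow> Y \<in> closure (rank_le_set CARD('n))" (is ?cl)
    and "multilinear_mult (mat 1) (mat 1) U Y \<in> interior (rank_le_set CARD('n))
      \<longleftrightarrow> Y \<in> interior (rank_le_set CARD('n))" (is ?int)
proof -
  define T where "T U Y = multilinear_mult (mat 1) (mat 1) U Y" for U :: "real^2^2" and Y :: "real^2^'n^'n"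
  have Teq: "T U Y = pencil (U $ 1 $ 1 *\<^sub>R frontal_slice Y 1 + U $ 1 $ 2 *\<^sub>R frontal_slice Y 2)
    (U $ 2 $ 1 *\<^sub>R frontal_slice Y 1 + U $ 2 $ 2 *\<^sub>R frontal_slice Y 2)" for U Y
    unfolding T_def by (rule mix_slices_eq)
  have lin: "linear (T U)" for U
  proof (rule linearI)
    show "T U (Y + Z) = T U Y + T U Z" for Y Z
      unfolding Teq by (simp add: frontal_slice_add algebra_simps flip: pencil_add)
    show "T U (c *\<^sub>R Y) = c *\<^sub>R T U Y" for c Y
      unfolding Teq by (simp add: frontal_slice_scaleR algebra_simps flip: pencil_scaleR)
  qed
  have comp: "T U (T V Y) = T (U ** V) Y" for U V Y
    unfolding Teq by (simp add: matrix_matrix_mult_def sum_2 algebra_simps)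
  have one: "T (mat 1) Y = Y" for Y
    unfolding Teq by (simp add: mat_def pencil_frontal_slices)
  have mem: "T U Y \<in> rank_le_set CARD('n)" if "Y \<in> rank_le_set CARD('n)" for U Y
  proof -
    have "pencil (frontal_slice Y 1) (frontal_slice Y 2) \<in> rank_le_set CARD('n)"
      using that by (simp add: pencil_frontal_slices)
    then obtain X W :: "real^'n^'n" and d e
      where XW: "frontal_slice Y 1 = X ** diag d ** W" "frontal_slice Y 2 = X ** diag e ** W"
      using pencil_in_rank_le_iff by blast
    have "a *\<^sub>R frontal_slice Y 1 + b *\<^sub>R frontal_slice Y 2 = X ** diag (\<lambda>i. a * d i + b * e i) ** W" for a b
      using matrix_diag_add[of X "\<lambda>_. 0" W a d] matrix_diag_add[of X "\<lambda>i. a * d i" W b e]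
      by (simp add: XW vec_eq_iff matrix_diag_matrix_nth)
    then show ?thesis unfolding Teq pencil_in_rank_le_iff by blast
  qed
  have inv: "T (matrix_inv U) (T U Y) = Y" "T U (T (matrix_inv U) Y) = Y" for Y
    by (simp_all add: comp one matrix_inv_inverse[OF U])
  show ?cl ?int
    using invariant_under_linear_bijection[OF lin inv mem mem, of Y]
    by (simp_all add: T_def)
qed

section \<open>Matrices whose characteristic polynomial splits over the reals\<close>

lemma poly_det: "poly (det M) t = det (\<chi> i j. poly (M $ i $ j) t)" for M :: "'a::comm_ring_1 poly^'n^'n"
  by (simp add: det_def poly_sum poly_prod)

lemma degree_det_le:
  fixes M :: "'a::comm_ring_1 poly^'n^'n"
  assumes "\<And>i j. degree (M $ i $ j) \<le> 1"
  shows "degree (det M) \<le> CARD('n)"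
  unfolding det_def
proof (rule degree_sum_le)
  fix p :: "'n \<Rightarrow> 'n"
  have "degree (of_int (sign p) * (\<Prod>i\<in>UNIV. M $ i $ p i))
      \<le> degree (of_int (sign p) :: 'a poly) + degree (\<Prod>i\<in>UNIV. M $ i $ p i)" by (rule degree_mult_le)
  also have "\<dots> \<le> 0 + (\<Sum>i\<in>(UNIV::'n set). 1)"
    using assms
    by (intro add_mono order_trans[OF degree_prod_sum_le] sum_mono) (auto simp: o_def)
  finally show "degree (of_int (sign p) * (\<Prod>i\<in>UNIV. M $ i $ p i)) \<le> CARD('n)" by simp
qed simp

lemma poly_char_polynomial: "poly (char_polynomial A) t = det (t *\<^sub>R mat 1 - A)" for A :: "real^'n^'n"
proof -
  have "(\<chi> i j. poly (((if i = j then [:0, 1:] else 0) - [:A $ i $ j:])) t) = t *\<^sub>R mat 1 - A"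
    by (simp add: vec_eq_iff mat_def)
  then show ?thesis by (simp add: char_polynomial_def poly_det)
qed

lemma eigvals_eq_roots: "eigvals A = {t. det (A - t *\<^sub>R mat 1) = 0}" for A :: "real^'n^'n"
  by (auto simp: eigvals_def det_pencil_eq_0_iff scalar_mult_eq_scaleR)

lemma char_polynomial_root_iff: "poly (char_polynomial A) t = 0 \<longleftrightarrow> t \<in> eigvals A" for A :: "real^'n^'n"
  unfolding poly_char_polynomial det_eq_0_iff_kernel eigvals_def
  by (auto simp: matrix_vector_mult_diff_rdistrib scalar_mult_eq_scaleR simp flip: scaleR_matrix_vector_assoc)

text \<open>
  A matrix has only finitely many eigenvalues.
\<close>
lemma char_polynomial_nonzero: "char_polynomial A \<noteq> 0" for A :: "real^'n^'n"
proof
  assume "char_polynomial A = 0"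
  then have "eigvals A = UNIV" using char_polynomial_root_iff[of A] by auto
  moreover have "finite (eigvals A)"
    unfolding eigvals_eq_roots by (rule finite_pencil_roots) (simp add: invertible_det_nz)
  ultimately show False using infinite_UNIV_char_0[where 'a = real] by simp
qed

lemma orthogonal_projection_matrix:
  fixes W :: "(real^'n) set"
  assumes "subspace W"
  obtains P :: "real^'n^'n" where "\<forall>x. P *v x \<in> W" "\<forall>x\<in>W. P *v x = x"
    "\<forall>x. \<forall>w\<in>W. (x - P *v x) \<bullet> w = 0"
proof -
  define p where "p x = (SOME y. y \<in> W \<and> (\<forall>w\<in>W. (x - y) \<bullet> w = 0))" for x
  have "\<exists>y. y \<in> W \<and> (\<forall>w\<in>W. (x - y) \<bullet> w = 0)" for x
  proof -
    obtain y z where "y \<in> span W" "\<And>w. w \<in> span W \<Longrightarrow> orthogonal z w" "x = y + z"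
      using orthogonal_subspace_decomp_exists by blast
    moreover have "span W = W" using assms by (simp add: span_eq_iff)
    ultimately show ?thesis by (intro exI[of _ y]) (simp add: orthogonal_def)
  qed
  from someI_ex[OF this]
  have p: "p x \<in> W" "\<And>w. w \<in> W \<Longrightarrow> (x - p x) \<bullet> w = 0" for x
    unfolding p_def by blast+
  have unique: "p x = y" if "y \<in> W" "\<And>w. w \<in> W \<Longrightarrow> (x - y) \<bullet> w = 0" for x y
  proof -
    have mem: "p x - y \<in> W" using p(1) that(1) assms by (rule subspace_diff[rotated 1])
    have "(p x - y) \<bullet> (p x - y) = (x - y) \<bullet> (p x - y) - (x - p x) \<bullet> (p x - y)"
      by (simp add: inner_diff_left)
    also have "\<dots> = 0" using that(2)[OF mem] p(2)[OF mem] by simp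
    finally show ?thesis by simp
  qed
  have "linear p"
  proof (rule linearI)
    show "p (x + y) = p x + p y" for x y
    proof (rule unique)
      show "(x + y - (p x + p y)) \<bullet> w = 0" if "w \<in> W" for w
        using p(2)[OF that, of x] p(2)[OF that, of y] by (simp add: algebra_simps)
    qed (simp add: assms p(1) subspace_add)
    show "p (c *\<^sub>R x) = c *\<^sub>R p x" for c x
    proof (rule unique)
      show "(c *\<^sub>R x - c *\<^sub>R p x) \<bullet> w = 0" if "w \<in> W" for w
        using p(2)[OF that, of x] by (simp add: algebra_simps)
    qed (simp add: assms p(1) subspace_scale)
  qed
  then have "matrix p *v x = p x" for x by (simp add: matrix_works)
  then show ?thesis using that[of "matrix p"] p unique by auto
qed

text \<open>
  The vector \<open>v\<close> is an eigenvector of the map that \<open>A\<close> induces on the quotient by \<open>W\<close>, realized on the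
  orthogonal complement. Let \<open>P\<close> and \<open>Q\<close> be the orthogonal projections onto \<open>W\<close> and its complement.
  Invariance of \<open>W\<close> gives \<open>t I - A = (P + Q (t I - A) Q) (P (t I - A) + Q)\<close>, so the characteristic
  polynomial factors as \<open>p1 p2\<close>. As it splits over the reals, so does \<open>p1\<close>, and a real root of \<open>p1\<close> is the
  required eigenvalue.
\<close>
lemma real_eigenvector_modulo_invariant_subspace:
  fixes A :: "real^'n^'n"
  assumes split: "(\<Sum>c\<in>eigvals A. alg_mult A c) = CARD('n)"
    and W: "subspace W" "\<And>x. x \<in> W \<Longrightarrow> A *v x \<in> W" "W \<noteq> UNIV"
  shows "\<exists>v t. v \<noteq> 0 \<and> (\<forall>w\<in>W. v \<bullet> w = 0) \<and> A *v v - t *\<^sub>R v \<in> W"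
proof -
  obtain P :: "real^'n^'n" where "\<forall>x. P *v x \<in> W" "\<forall>x\<in>W. P *v x = x"
    "\<forall>x. \<forall>w\<in>W. (x - P *v x) \<bullet> w = 0"
    by (rule orthogonal_projection_matrix[OF W(1)])
  then have P: "\<And>x. P *v x \<in> W" "\<And>x. x \<in> W \<Longrightarrow> P *v x = x"
    "\<And>x w. w \<in> W \<Longrightarrow> (x - P *v x) \<bullet> w = 0"
    by simp_all
  define Q where "Q = mat 1 - P"
  have Qv: "Q *v x = x - P *v x" for x by (simp add: Q_def matrix_vector_mult_diff_rdistrib)
  have QW: "Q *v x = 0" if "x \<in> W" for x using that by (simp add: Qv P(2))
  have PQ: "P *v (Q *v x) = 0" and QQ: "Q *v (Q *v x) = Q *v x" and QP: "Q *v (P *v x) = 0" and PP: "P *v (P *v x) = P *v x" for x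
    using P(1,2) by (simp_all add: Qv matrix_vector_mult_diff_distrib)
  define D1 where "D1 = P - Q ** A ** Q"
  define D2 where "D2 = Q - P ** A"
  define p1 where "p1 = det (\<chi> i j. [:D1 $ i $ j, Q $ i $ j:])"
  define p2 where "p2 = det (\<chi> i j. [:D2 $ i $ j, P $ i $ j:])"
  have p1: "poly p1 t = det (D1 + t *\<^sub>R Q)" and p2: "poly p2 t = det (D2 + t *\<^sub>R P)" for t
    by (auto simp: p1_def p2_def poly_det intro!: arg_cong[where f = det] simp: vec_eq_iff)
  note mv = matrix_vector_mult_diff_rdistrib matrix_vector_mult_add_rdistrib matrix_vector_right_distrib
    matrix_vector_mult_diff_distrib matrix_vector_mult_scaleR
  note mv' = matrix_vector_mul_assoc[symmetric] scaleR_matrix_vector_assoc[symmetric]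
  have "(D1 + t *\<^sub>R Q) ** (D2 + t *\<^sub>R P) = t *\<^sub>R mat 1 - A" for t
    unfolding matrix_eq
  proof
    fix x
    have "Q *v (A *v (P *v x)) = 0" using P(1) W(2) QW by blast
    then have "Q *v (A *v (Q *v x)) = Q *v (A *v x)" by (simp add: Qv[of x] mv)
    then have "((D1 + t *\<^sub>R Q) ** (D2 + t *\<^sub>R P)) *v x
        = t *\<^sub>R (P *v x) + t *\<^sub>R (Q *v x) - P *v (A *v x) - Q *v (A *v x)"
      by (simp add: mv mv' D1_def D2_def PQ QQ QP PP)
    also have "\<dots> = (t *\<^sub>R mat 1 - A) *v x"
      by (simp add: mv mv' Qv algebra_simps)
    finally show "((D1 + t *\<^sub>R Q) ** (D2 + t *\<^sub>R P)) *v x = (t *\<^sub>R mat 1 - A) *v x" .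
  qed
  then have "poly (char_polynomial A) t = poly (p1 * p2) t" for t
    by (simp add: poly_char_polynomial p1 p2 flip: det_mul)
  then have char: "char_polynomial A = p1 * p2" by (simp flip: poly_eq_poly_eq_iff add: fun_eq_iff)
  then have nz: "p1 \<noteq> 0" "p2 \<noteq> 0" using char_polynomial_nonzero[of A] by auto
  have "size (proots (char_polynomial A)) = (\<Sum>c\<in>eigvals A. alg_mult A c)"
    by (simp add: size_multiset_overloaded_eq char_polynomial_nonzero char_polynomial_root_iff alg_mult_def)
  then have "CARD('n) = size (proots p1) + size (proots p2)"
    using split nz by (simp add: char proots_mult)
  moreover have "degree p1 + degree p2 \<le> CARD('n)"
  proof -
    have "degree (char_polynomial A) \<le> CARD('n)"
      unfolding char_polynomial_def by (rule degree_det_le) auto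
    then show ?thesis using nz by (simp add: char degree_mult_eq)
  qed
  \<comment> \<open>both factors have at most as many roots as their degree, and the total is attained\<close>
  ultimately have size: "degree p1 \<le> size (proots p1)"
    using size_proots_le[of p2] by linarith
  \<comment> \<open>if \<open>p1\<close> were constant, \<open>det (s Q + P) p1(1 / s) = det (I - s Q A Q)\<close> would give \<open>0 = 1\<close> at \<open>s = 0\<close>\<close>
  have "degree p1 \<noteq> 0"
  proof
    assume "degree p1 = 0"
    then obtain c where c: "p1 = [:c:]" by (rule degree_eq_zeroE)
    have eq: "det (s *\<^sub>R Q + P) * c = det (mat 1 - s *\<^sub>R (Q ** A ** Q))" if "s \<noteq> 0" for s
    proof -
      have "(s *\<^sub>R Q + P) ** (D1 + (1 / s) *\<^sub>R Q) = mat 1 - s *\<^sub>R (Q ** A ** Q)"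
        unfolding matrix_eq
      proof
        fix x
        have "((s *\<^sub>R Q + P) ** (D1 + (1 / s) *\<^sub>R Q)) *v x = P *v x + Q *v x - s *\<^sub>R (Q *v (A *v (Q *v x)))"
          using that by (simp add: mv mv' D1_def PQ QQ QP PP)
        then show "((s *\<^sub>R Q + P) ** (D1 + (1 / s) *\<^sub>R Q)) *v x = (mat 1 - s *\<^sub>R (Q ** A ** Q)) *v x"
          by (simp add: mv mv' Qv[of x])
      qed
      moreover have "det (D1 + (1 / s) *\<^sub>R Q) = c" using p1[of "1 / s"] by (simp add: c)
      ultimately show ?thesis by (metis det_mul)
    qed
    define g where "g s = det (s *\<^sub>R Q + P) * c - det (mat 1 - s *\<^sub>R (Q ** A ** Q))" for s
    have "continuous_on UNIV g" unfolding g_def by (intro continuous_intros)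
    then have "(g \<longlongrightarrow> g 0) (at 0)" by (simp add: continuous_on_def)
    moreover have "(g \<longlongrightarrow> 0) (at 0)"
      by (rule tendsto_eventually) (auto simp: eventually_at_filter g_def eq)
    ultimately have "g 0 = 0" using tendsto_unique[OF trivial_limit_at] by blast
    moreover have "det P = 0"
    proof -
      obtain x where "x \<notin> W" using W(3) by auto
      then have "Q *v x \<noteq> 0" using P(1)[of x] by (auto simp: Qv)
      then show ?thesis using PQ det_eq_0_iff_kernel by blast
    qed
    ultimately show False by (simp add: g_def)
  qed
  then have "proots p1 \<noteq> {#}" using size by auto
  then obtain t where "t \<in># proots p1" by (rule multiset_nonemptyE)
  then have "poly p1 t = 0" using nz(1) by simp
  then obtain x where x: "x \<noteq> 0" "(D1 + t *\<^sub>R Q) *v x = 0" using p1 det_eq_0_iff_kernel by metis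
  then have eq: "P *v x = Q *v (A *v (Q *v x) - t *\<^sub>R x)"
    by (simp add: mv mv' D1_def algebra_simps)
  have "(Q *v y) \<bullet> (P *v x) = 0" for y
    unfolding Qv by (rule P(3)[OF P(1)])
  then have "(P *v x) \<bullet> (P *v x) = 0" using eq by metis
  then have Px: "P *v x = 0" by simp
  then have "Q *v x = x" by (simp add: Qv)
  then have "Q *v (A *v x - t *\<^sub>R x) = 0" using eq Px by metis
  then have "A *v x - t *\<^sub>R x \<in> W" using P(1)[of "A *v x - t *\<^sub>R x"] by (simp add: Qv)
  moreover have "\<forall>w\<in>W. x \<bullet> w = 0" using P(3)[of _ x] Px by simp
  ultimately show ?thesis using x(1) by blast
qed

definition rank1 :: "real^'n \<Rightarrow> real^'m \<Rightarrow> real^'m^'n" where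
  "rank1 u v = (\<chi> i j. u $ i * v $ j)"

lemma rank1_mult_vec [simp]: "rank1 u v *v x = (v \<bullet> x) *\<^sub>R u"
  by (simp add: rank1_def matrix_vector_mult_def inner_vec_def vec_eq_iff sum_distrib_left mult_ac)

lemma vec_mult_rank1 [simp]: "x v* rank1 u v = (x \<bullet> u) *\<^sub>R v"
  by (simp add: rank1_def vector_matrix_mult_def inner_vec_def vec_eq_iff sum_distrib_right sum_distrib_left mult_ac)

lemma closed_perturbation_limit:
  fixes f :: "real \<Rightarrow> 'a::topological_space"
  assumes "continuous_on UNIV f" "closed C" "\<forall>\<^sub>F \<epsilon> in at_right 0. f \<epsilon> \<in> C"
  shows "f 0 \<in> C"
proof (rule ccontr)
  assume "f 0 \<notin> C"
  then have "\<forall>\<^sub>F \<epsilon> in at_right 0. f \<epsilon> \<in> - C"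
    using open_meets_perturbation[OF assms(1), of "- C"] assms(2) by auto
  then have "\<forall>\<^sub>F \<epsilon> in at_right (0::real). False"
    using assms(3) by eventually_elim simp
  then show False by simp
qed

lemma eventually_at_right_0_avoids_finite:
  assumes "finite F"
  shows "\<forall>\<^sub>F \<epsilon> in at_right (0::real). \<epsilon> \<notin> F"
proof -
  have "open (- (F - {0}))" using assms by (intro open_Compl finite_imp_closed) simp
  then have "\<forall>\<^sub>F \<epsilon> in at_right 0. \<epsilon> \<in> - (F - {0})"
    using open_meets_perturbation[OF continuous_on_id, of "- (F - {0})"] by simp
  then show ?thesis using eventually_at_right_less[of 0] by eventually_elim auto
qed

text \<open>
  Triangularization and perturbation in one induction. The matrix \<open>A\<close> is a perturbation of \<open>A0\<close>
  that agrees with it modulo \<open>W\<close> and has \<open>dim W\<close> distinct real eigenvalues on \<open>W\<close>. If \<open>v\<close> is an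
  eigenvector of \<open>A0\<close> modulo \<open>W\<close> and orthogonal to \<open>W\<close>, then \<open>A + \<epsilon> v v\<^sup>T\<close> is unchanged on \<open>W\<close> and has
  a shifted eigenvalue on \<open>W + span {v}\<close>, which avoids the previous ones for small \<open>\<epsilon>\<close>. Since
  \<open>A0\<close> stays fixed, the hypothesis on quotients does not have to be transported to the perturbations.
\<close>
lemma eigenvectors_modulo_invariant_imp_closure:
  fixes A A0 :: "real^'n^'n"
  assumes eig: "\<And>W. subspace W \<Longrightarrow> (\<And>x. x \<in> W \<Longrightarrow> A0 *v x \<in> W) \<Longrightarrow> W \<noteq> UNIV \<Longrightarrow>
      \<exists>v t. v \<noteq> 0 \<and> (\<forall>w\<in>W. v \<bullet> w = 0) \<and> A0 *v v - t *\<^sub>R v \<in> W"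
    and "subspace W" "\<And>x. x \<in> W \<Longrightarrow> A0 *v x \<in> W" "\<And>x. A *v x - A0 *v x \<in> W"
    and "finite \<Lambda>" "card \<Lambda> = dim W" "\<And>t. t \<in> \<Lambda> \<Longrightarrow> \<exists>b\<in>W. b \<noteq> 0 \<and> A *v b = t *\<^sub>R b"
  shows "pencil (mat 1) A \<in> closure (rank_le_set CARD('n))"
  using assms(2-)
proof (induction "CARD('n) - dim W" arbitrary: A W \<Lambda> rule: less_induct)
  case less
  note W = less.prems(1-3) and \<Lambda> = less.prems(4-6)
  have inv: "invertible (mat 1 :: real^'n^'n)" by (simp add: invertible_det_nz)
  show ?case
  proof (cases "W = UNIV")
    case True
    then have "pencil (mat 1) A \<in> rank_le_set CARD('n)"
      using \<Lambda> inv by (intro distinct_roots_imp_rank_le[where \<Lambda> = \<Lambda>]) (auto simp: det_pencil_eq_0_iff)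
    then show ?thesis using closure_subset by blast
  next
    case False
    then obtain v t where v: "v \<noteq> 0" "\<And>w. w \<in> W \<Longrightarrow> v \<bullet> w = 0" "A0 *v v - t *\<^sub>R v \<in> W"
      using eig[OF W(1,2)] by blast
    define A' where "A' \<epsilon> = A + \<epsilon> *\<^sub>R rank1 v v" for \<epsilon>
    define t' where "t' \<epsilon> = t + \<epsilon> * (v \<bullet> v)" for \<epsilon>
    have A'x: "A' \<epsilon> *v x = A *v x + (\<epsilon> * (v \<bullet> x)) *\<^sub>R v" for \<epsilon> x
      by (simp add: A'_def matrix_vector_mult_add_rdistrib flip: scaleR_matrix_vector_assoc)
    define W' where "W' = span (insert v W)"
    have W'_iff: "x \<in> W' \<longleftrightarrow> (\<exists>k. x - k *\<^sub>R v \<in> W)" for x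
      unfolding W'_def span_breakdown_eq using W(1) by (metis span_eq_iff)
    have "v \<notin> W" using v(1,2) by (metis inner_eq_zero_iff)
    then have dim: "dim W' = Suc (dim W)"
      using W(1) by (simp add: W'_def dim_insert span_eq_iff[THEN iffD2])
    have AW: "A *v x \<in> W" if "x \<in> W" for x
      using subspace_add[OF W(1) W(3)[of x] W(2)[OF that]] by simp
    have "v \<bullet> v \<noteq> 0" using v(1) by simp
    then have "inj (\<lambda>\<epsilon>. t + \<epsilon> * (v \<bullet> v))" by (simp add: inj_def)
    then have "finite ((\<lambda>\<epsilon>. t + \<epsilon> * (v \<bullet> v)) -` \<Lambda>)" using \<Lambda>(1) by (rule finite_vimageI[rotated])
    then have "\<forall>\<^sub>F \<epsilon> in at_right 0. t' \<epsilon> \<notin> \<Lambda>"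
      using eventually_at_right_0_avoids_finite unfolding t'_def vimage_def by fastforce
    then have "\<forall>\<^sub>F \<epsilon> in at_right 0. pencil (mat 1) (A' \<epsilon>) \<in> closure (rank_le_set CARD('n))"
    proof (rule eventually_mono)
      fix \<epsilon> assume fresh: "t' \<epsilon> \<notin> \<Lambda>"
      define f where "f x = A *v x - t' \<epsilon> *\<^sub>R x" for x
      have f: "linear f"
        unfolding f_def by (intro linear_compose_sub matrix_vector_mul_linear linear_scale_self)
      have fW: "f ` W \<subseteq> W"
        using AW W(1) by (auto simp: f_def intro!: subspace_diff subspace_scale)
      \<comment> \<open>\<open>W\<close> has no room for a further eigenvalue, so \<open>A - t' I\<close> maps \<open>W\<close> onto itself\<close>
      have "x = 0" if "x \<in> W" "f x = 0" for x
      proof (rule ccontr)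
        assume "x \<noteq> 0"
        then have "card (insert (t' \<epsilon>) \<Lambda>) \<le> dim W"
          using \<Lambda> that
          by (intro card_generalized_eigenvalues_le_dim[OF inv, where B = A]) (auto simp: f_def)
        then show False using fresh \<Lambda> by simp
      qed
      then have "inj_on f W" using linear_inj_on_iff_eq_0[OF f W(1)] by blast
      then have "inj_on f (span W)" using W(1) by (simp add: span_eq_iff[THEN iffD2])
      then have "dim (f ` W) = dim W" by (rule dim_image_eq[OF f])
      then have "f ` W = W"
        using subspace_dim_equal[OF linear_subspace_image[OF f W(1)] W(1) fW] by simp
      moreover have "A' \<epsilon> *v v - t' \<epsilon> *\<^sub>R v \<in> W"
      proof -
        have "A' \<epsilon> *v v - t' \<epsilon> *\<^sub>R v = (A *v v - A0 *v v) + (A0 *v v - t *\<^sub>R v)"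
          by (simp add: A'x t'_def scaleR_add_left)
        then show ?thesis using subspace_add[OF W(1) W(3)[of v] v(3)] by presburger
      qed
      then have "- (A' \<epsilon> *v v - t' \<epsilon> *\<^sub>R v) \<in> W" by (rule subspace_neg[OF W(1)])
      ultimately obtain c where c: "c \<in> W" "f c = - (A' \<epsilon> *v v - t' \<epsilon> *\<^sub>R v)" by (metis imageE)
      show "pencil (mat 1) (A' \<epsilon>) \<in> closure (rank_le_set CARD('n))"
      proof (rule less.hyps[where W = W' and \<Lambda> = "insert (t' \<epsilon>) \<Lambda>"])
        show "CARD('n) - dim W' < CARD('n) - dim W"
          using dim dim_subset_UNIV_cart[of W'] by linarith
        show "subspace W'" by (simp add: W'_def)
        show "A0 *v x \<in> W'" if x: "x \<in> W'" for x
        proof -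
          obtain k where "x - k *\<^sub>R v \<in> W" using x unfolding W'_iff by blast
          then have "A0 *v (x - k *\<^sub>R v) + k *\<^sub>R (A0 *v v - t *\<^sub>R v) \<in> W"
            by (intro subspace_add[OF W(1)] subspace_scale[OF W(1)] W(2) v(3))
          then have "A0 *v x - (k * t) *\<^sub>R v \<in> W" by (simp add: algebra_simps)
          then show ?thesis unfolding W'_iff by blast
        qed
        show "A' \<epsilon> *v x - A0 *v x \<in> W'" for x
          unfolding W'_iff using W(3)[of x] by (intro exI[of _ "\<epsilon> * (v \<bullet> x)"]) (simp add: A'x)
        show "finite (insert (t' \<epsilon>) \<Lambda>)" "card (insert (t' \<epsilon>) \<Lambda>) = dim W'"
          using \<Lambda> fresh dim by simp_all
        show "\<exists>b\<in>W'. b \<noteq> 0 \<and> A' \<epsilon> *v b = s *\<^sub>R b" if s: "s \<in> insert (t' \<epsilon>) \<Lambda>" for s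
        proof (cases "s = t' \<epsilon>")
          case True
          have "v + c \<in> W'" unfolding W'_iff using c(1) by (intro exI[of _ 1]) simp
          moreover have "v + c \<noteq> 0" using \<open>v \<notin> W\<close> c(1) W(1)
            by (metis add.commute add_eq_0_iff subspace_neg)
          moreover have "A' \<epsilon> *v (v + c) = s *\<^sub>R (v + c)"
          proof -
            have "A' \<epsilon> *v c = A *v c" using v(2)[OF c(1)] by (simp add: A'x)
            then show ?thesis using c(2) True by (simp add: f_def algebra_simps)
          qed
          ultimately show ?thesis by blast
        next
          case False
          then obtain b where b: "b \<in> W" "b \<noteq> 0" "A *v b = s *\<^sub>R b" using \<Lambda>(3)[of s] s by auto
          moreover have "A' \<epsilon> *v b = A *v b" using v(2)[OF b(1)] by (simp add: A'x)
          moreover have "b \<in> W'" unfolding W'_iff using b(1) by (intro exI[of _ 0]) simp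
          ultimately show ?thesis by metis
        qed
      qed
    qed
    moreover have "continuous_on UNIV (\<lambda>\<epsilon>. pencil (mat 1) (A' \<epsilon>))"
      unfolding A'_def by (intro continuous_intros)
    ultimately have "pencil (mat 1) (A' 0) \<in> closure (rank_le_set CARD('n))"
      using closed_perturbation_limit[where f = "\<lambda>\<epsilon>. pencil (mat 1) (A' \<epsilon>)"] closed_closure by blast
    then show ?thesis by (simp add: A'_def)
  qed
qed

lemma splitting_char_polynomial_imp_closure:
  fixes A :: "real^'n^'n"
  assumes "(\<Sum>c\<in>eigvals A. alg_mult A c) = CARD('n)"
  shows "pencil (mat 1) A \<in> closure (rank_le_set CARD('n))"
  by (rule eigenvectors_modulo_invariant_imp_closure[OF real_eigenvector_modulo_invariant_subspace[OF assms],
      where W = "{0}" and \<Lambda> = "{}"]) auto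

section \<open>Krylov spaces of a singular pencil\<close>

text \<open>
  The determinant is a polynomial in the parameter.
\<close>
lemma det_affine_eq_0:
  fixes C D :: "real^'n^'n"
  assumes "infinite T" "\<And>t. t \<in> T \<Longrightarrow> det (D + t *\<^sub>R C) = 0"
  shows "det (D + t *\<^sub>R C) = 0"
proof -
  define p where "p = det (\<chi> i j. [:D $ i $ j, C $ i $ j:])"
  have p: "poly p t = det (D + t *\<^sub>R C)" for t
    by (auto simp: p_def poly_det vec_eq_iff intro!: arg_cong[where f = det])
  have "p = 0"
  proof (rule ccontr)
    assume "p \<noteq> 0"
    then have "finite {t. poly p t = 0}" by (rule poly_roots_finite)
    moreover have "T \<subseteq> {t. poly p t = 0}" using assms(2) by (auto simp: p)
    ultimately show False using assms(1) finite_subset by blast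
  qed
  then show ?thesis using p[of t] by simp
qed

lemma separating_vector:
  fixes b :: "'a::euclidean_space"
  assumes "b \<notin> span S"
  shows "\<exists>w. (\<forall>x\<in>span S. w \<bullet> x = 0) \<and> w \<bullet> b = 1"
proof -
  obtain y z where yz: "y \<in> span S" "\<And>w. w \<in> span S \<Longrightarrow> orthogonal z w" "b = y + z"
    using orthogonal_subspace_decomp_exists by blast
  have "z \<noteq> 0" using assms yz by auto
  moreover have "z \<bullet> b = z \<bullet> z" using yz by (simp add: orthogonal_def inner_add_right)
  ultimately show ?thesis
    using yz(2) by (intro exI[of _ "z /\<^sub>R (z \<bullet> z)"]) (auto simp: orthogonal_def)
qed

text \<open>
  Here \<open>x s = (I - s P)\<^sup>-\<^sup>1 a\<close> is the generating function of the vectors \<open>P\<^sup>j a\<close>, so orthogonality to all its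
  values for small \<open>s\<close> means orthogonality to all coefficients. The proof reads off one coefficient after
  the other as \<open>s\<close> tends to zero, using only that \<open>x\<close> stays bounded.
\<close>
lemma krylov_orthogonal:
  fixes P :: "real^'n^'n"
  assumes \<delta>: "0 < \<delta>" and x: "\<And>s. 0 < s \<Longrightarrow> s < \<delta> \<Longrightarrow> x s = a + s *\<^sub>R (P *v x s)"
    and w: "\<And>s. 0 < s \<Longrightarrow> s < \<delta> \<Longrightarrow> w \<bullet> x s = 0"
  shows "w \<bullet> (((*v) P ^^ j) a) = 0"
proof -
  obtain C where C: "C > 0" "\<And>y. norm (P *v y) \<le> norm y * C"
    using bounded_linear.pos_bounded[OF matrix_vector_mul_bounded_linear[of P]] by metis
  define \<eta> where "\<eta> = min \<delta> (1 / (2 * C))"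
  have \<eta>: "0 < \<eta>" "\<eta> \<le> \<delta>" "\<eta> \<le> 1 / (2 * C)" using \<delta> C by (auto simp: \<eta>_def)
  have bound: "norm (x s) \<le> 2 * norm a" if s: "0 < s" "s < \<eta>" for s
  proof -
    have "norm (x s) \<le> norm a + s * norm (P *v x s)"
      using norm_triangle_ineq[of a "s *\<^sub>R (P *v x s)"] x[of s] s \<eta>(2) by simp
    also have "\<dots> \<le> norm a + s * (norm (x s) * C)"
      using C(2)[of "x s"] s by (intro add_left_mono mult_left_mono) auto
    also have "\<dots> = norm a + (s * C) * norm (x s)" by simp
    also have "\<dots> \<le> norm a + (1 / 2) * norm (x s)"
    proof -
      have "s < 1 / (2 * C)" using s(2) \<eta>(3) by simp
      then have "s * C \<le> 1 / 2" using C(1) by (simp add: field_simps)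
      then show ?thesis by (intro add_left_mono mult_right_mono) auto
    qed
    finally show ?thesis by simp
  qed
  have lin: "linear ((*v) P ^^ j)" for j
  proof (induction j)
    case (Suc j)
    then show ?case
      using linear_compose[OF Suc matrix_vector_mul_linear[of P]] by (simp only: funpow.simps)
  qed (simp add: linear_id[unfolded id_def] id_def)
  \<comment> \<open>each coefficient is the value at \<open>s = 0\<close> of the previous remainder\<close>
  have step: "w \<bullet> (((*v) P ^^ j) a) = 0 \<and> (\<forall>s. 0 < s \<and> s < \<delta> \<longrightarrow> w \<bullet> (((*v) P ^^ Suc j) (x s)) = 0)"
    if prev: "\<And>s. 0 < s \<Longrightarrow> s < \<delta> \<Longrightarrow> w \<bullet> (((*v) P ^^ j) (x s)) = 0" for j
  proof -
    have exp: "w \<bullet> (((*v) P ^^ j) a) = - s * (w \<bullet> (((*v) P ^^ Suc j) (x s)))" if s: "0 < s" "s < \<delta>" for s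
    proof -
      have e: "((*v) P ^^ j) (x s) = ((*v) P ^^ j) a + s *\<^sub>R (((*v) P ^^ Suc j) (x s))"
        by (subst x[OF s]) (simp add: linear_add[OF lin] linear_scale[OF lin] funpow_swap1)
      show ?thesis
        using prev[OF s] arg_cong[OF e, of "\<lambda>y. w \<bullet> y"] by (simp add: inner_add_right)
    qed
    obtain K where K: "K > 0" "\<And>y. norm (((*v) P ^^ Suc j) y) \<le> K * norm y"
      using linear_bounded_pos[OF lin[of "Suc j"]] by metis
    define M where "M = norm w * (K * (2 * norm a))"
    have le: "\<bar>w \<bullet> (((*v) P ^^ j) a)\<bar> \<le> s * M" if s: "0 < s" "s < \<eta>" for s
    proof -
      have "\<bar>w \<bullet> (((*v) P ^^ Suc j) (x s))\<bar> \<le> norm w * norm (((*v) P ^^ Suc j) (x s))"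
        by (rule Cauchy_Schwarz_ineq2)
      also have "\<dots> \<le> M" unfolding M_def
        using K(1) by (intro mult_left_mono order_trans[OF K(2)] bound[OF s]) auto
      finally show ?thesis using exp[of s] s \<eta>(2) by (simp add: abs_mult mult_left_mono)
    qed
    have "((\<lambda>s. s * M) \<longlongrightarrow> 0 * M) (at_right 0)" by (intro tendsto_intros)
    moreover have "\<forall>\<^sub>F s in at_right 0. \<bar>w \<bullet> (((*v) P ^^ j) a)\<bar> \<le> s * M"
      using \<eta>(1) le by (intro eventually_at_rightI[of 0 \<eta>]) auto
    ultimately have "\<bar>w \<bullet> (((*v) P ^^ j) a)\<bar> \<le> 0"
      using tendsto_le[OF trivial_limit_at_right_real _ tendsto_const] by fastforce
    then have 0: "w \<bullet> (((*v) P ^^ j) a) = 0" by simp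
    have "w \<bullet> (((*v) P ^^ Suc j) (x s)) = 0" if "0 < s" "s < \<delta>" for s
      using exp[OF that] that 0 by simp
    then show ?thesis using 0 by blast
  qed
  have "(\<forall>s. 0 < s \<and> s < \<delta> \<longrightarrow> w \<bullet> (((*v) P ^^ j) (x s)) = 0)" for j
  proof (induction j)
    case 0
    then show ?case using w by simp
  next
    case (Suc j)
    then show ?case using step[of j] by blast
  qed
  then show ?thesis using step[of j] by blast
qed

lemma krylov_span_subset:
  fixes P :: "real^'n^'n"
  assumes "0 < \<delta>" and "\<And>s. 0 < s \<Longrightarrow> s < \<delta> \<Longrightarrow> x s = a + s *\<^sub>R (P *v x s)"
  shows "((*v) P ^^ j) a \<in> span (x ` {0<..<\<delta>})"
proof (rule ccontr)
  assume "((*v) P ^^ j) a \<notin> span (x ` {0<..<\<delta>})"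
  then obtain w where w: "\<forall>y\<in>span (x ` {0<..<\<delta>}). w \<bullet> y = 0" "w \<bullet> (((*v) P ^^ j) a) = 1"
    using separating_vector by blast
  have "w \<bullet> x s = 0" if "0 < s" "s < \<delta>" for s
  proof -
    have "x s \<in> span (x ` {0<..<\<delta>})" using that by (intro span_base imageI) simp
    then show ?thesis using w(1) by blast
  qed
  then have "w \<bullet> (((*v) P ^^ j) a) = 0"
    using assms by (intro krylov_orthogonal[where x = x and \<delta> = \<delta>])
  then show False using w(2) by simp
qed

text \<open>
  The index is the least one for which the next Krylov vector depends on the previous ones; the
  dimension bounds how long independence can last.
\<close>
lemma krylov_first_dependence:
  fixes P :: "real^'n^'n"
  assumes "a \<noteq> 0"
  defines "c \<equiv> \<lambda>j. ((*v) P ^^ j) a"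
  obtains j where "c (Suc j) \<in> span (c ` {..j})" "c j \<notin> span (c ` {..<j})"
proof -
  have ex: "\<exists>j. c (Suc j) \<in> span (c ` {..j})"
  proof (rule ccontr)
    assume "\<nexists>j. c (Suc j) \<in> span (c ` {..j})"
    then have new: "c (Suc j) \<notin> span (c ` {..j})" for j by blast
    have "Suc j \<le> dim (c ` {..j})" for j
    proof (induction j)
      case 0
      then show ?case using \<open>a \<noteq> 0\<close> by (simp add: c_def)
    next
      case (Suc j)
      have "c ` {..Suc j} = insert (c (Suc j)) (c ` {..j})" by (simp add: atMost_Suc)
      then show ?case using Suc new[of j] by (simp add: dim_insert)
    qed
    from this[of "CARD('n)"] show False using dim_subset_UNIV_cart[of "c ` {..CARD('n)}"] by simp
  qed
  define j where "j = (LEAST j. c (Suc j) \<in> span (c ` {..j}))"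
  have j: "c (Suc j) \<in> span (c ` {..j})" unfolding j_def using ex by (rule LeastI_ex)
  have "c j \<notin> span (c ` {..<j})"
  proof (cases j)
    case 0
    then show ?thesis using \<open>a \<noteq> 0\<close> by (simp add: c_def)
  next
    case (Suc k)
    then have "c (Suc k) \<notin> span (c ` {..k})"
      using not_less_Least[of k "\<lambda>j. c (Suc j) \<in> span (c ` {..j})"] by (simp add: j_def)
    then show ?thesis using Suc by (simp add: lessThan_Suc_atMost)
  qed
  then show ?thesis using that j by blast
qed

text \<open>
  Once one Krylov vector depends on its predecessors, their span is invariant under \<open>P\<close> and so
  contains the whole sequence.
\<close>
lemma krylov_span_stable:
  fixes P :: "real^'n^'n"
  defines "c \<equiv> \<lambda>a j. ((*v) P ^^ j) a"
  assumes "c a (Suc j) \<in> span (c a ` {..j})"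
  shows "c a m \<in> span (c a ` {..j})"
proof (induction m)
  case 0
  show ?case by (rule span_base) auto
next
  case (Suc m)
  have "P *v y \<in> span (c a ` {..j})" if "y \<in> span (c a ` {..j})" for y
    using that
  proof (induction rule: span_induct_alt)
    case base
    show ?case by (simp add: span_zero)
  next
    case (step k y z)
    then obtain i where i: "i \<le> j" "y = c a i" by auto
    have "c a (Suc i) \<in> span (c a ` {..j})"
    proof (cases "i = j")
      case False
      then show ?thesis using i by (intro span_base imageI) auto
    qed (use assms in simp)
    then have "P *v y \<in> span (c a ` {..j})" using i by (simp add: c_def)
    then show ?case using step(2)
      by (simp add: matrix_vector_right_distrib matrix_vector_mult_scaleR span_add span_scale)
  qed
  then show ?case using Suc by (simp add: c_def)
qed

section \<open>Singular pencils are boundary points\<close>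

lemma scaleR_rank1: "c *\<^sub>R rank1 u v = rank1 (c *\<^sub>R u) v"
  by (simp add: rank1_def vec_eq_iff)

text \<open>
  Along \<open>A + c u v\<^sup>T\<close> the determinant is affine in \<open>c\<close>, so two zeros force it to vanish identically. The
  proof uses a left null vector \<open>y\<close> of \<open>A\<close>: either it is orthogonal to \<open>u\<close> and remains a left null vector,
  or the null vector of the second matrix is orthogonal to \<open>v\<close> and remains a null vector.
\<close>
lemma singular_rank_one_line:
  fixes A :: "real^'n^'n"
  assumes "det A = 0" "det (A + c *\<^sub>R rank1 u v) = 0" "c \<noteq> 0"
  shows "det (A + c' *\<^sub>R rank1 u v) = 0"
proof -
  have mv: "(A + c *\<^sub>R rank1 u v) *v x = A *v x + (c * (v \<bullet> x)) *\<^sub>R u" for c x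
    by (simp add: matrix_vector_mult_add_rdistrib flip: scaleR_matrix_vector_assoc)
  obtain y where y: "y \<noteq> 0" "y v* A = 0" using assms(1) det_eq_0_iff_left_kernel by blast
  show ?thesis
  proof (cases "y \<bullet> u = 0")
    case True
    have "y v* (A + c' *\<^sub>R rank1 u v) = 0"
      using y True by (simp add: vector_matrix_mult_add_rdistrib scaleR_rank1)
    then show ?thesis using y(1) det_eq_0_iff_left_kernel by blast
  next
    case False
    obtain z where z: "z \<noteq> 0" "A *v z + (c * (v \<bullet> z)) *\<^sub>R u = 0"
      using assms(2) det_eq_0_iff_kernel mv by metis
    have "y \<bullet> (A *v z) = 0" using y by (simp flip: dot_lmul_matrix)
    then have "(c * (v \<bullet> z)) * (y \<bullet> u) = 0"
      using arg_cong[OF z(2), of "\<lambda>x. y \<bullet> x"] by (simp add: inner_add_right)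
    then have "v \<bullet> z = 0" using False assms(3) by simp
    then have "(A + c' *\<^sub>R rank1 u v) *v z = 0" using z(2) by (simp add: mv)
    then show ?thesis using z(1) det_eq_0_iff_kernel by blast
  qed
qed

text \<open>
  Extending \<open>{a}\<close> to a basis by values of \<open>x\<close> leaves \<open>a\<close> outside the span of the chosen values, so a
  vector \<open>v\<close> can be orthogonal to all of them but not to \<open>a\<close>.
\<close>
lemma independent_nodes:
  fixes x :: "real \<Rightarrow> 'a::euclidean_space"
  assumes "a \<noteq> 0" "d \<le> dim (x ` I)"
  obtains S v where "finite S" "S \<subseteq> I" "d \<le> Suc (card S)" "\<forall>s\<in>S. v \<bullet> x s = 0" "v \<bullet> a = 1"
proof -
  obtain B where B: "{a} \<subseteq> B" "B \<subseteq> insert a (x ` I)" "independent B" "insert a (x ` I) \<subseteq> span B"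
    using maximal_independent_subset_extend[of "{a}" "insert a (x ` I)"] assms(1) by auto
  have "B - {a} \<subseteq> x ` I" using B(2) by auto
  then obtain S where S: "S \<subseteq> I" "inj_on x S" "B - {a} = x ` S" unfolding subset_image_inj by auto
  have fin: "finite B" using B(3) by (rule independent_imp_finite)
  then have "finite (x ` S)" using S(3) by (metis finite_Diff)
  then have "finite S" using S(2) by (rule finite_imageD)
  have "d \<le> card B"
    using assms(2) B dim_le_card[of "x ` I" B] fin by auto
  also have "card B = Suc (card S)"
    using fin B(1) S by (metis card_Suc_Diff1 card_image insert_subset)
  finally have card: "d \<le> Suc (card S)" .
  have "a \<notin> span (x ` S)"
    using B(1,3) S(3) unfolding dependent_def by auto
  then obtain v where "\<forall>y\<in>span (x ` S). v \<bullet> y = 0" "v \<bullet> a = 1" using separating_vector by blast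
  then show ?thesis using that[of S v] \<open>finite S\<close> S(1) card by (auto intro: span_base)
qed

text \<open>
  The perturbed slices \<open>A' \<epsilon>\<close>, \<open>B' \<tau> \<epsilon>\<close> satisfy \<open>B' - t A' = B - t A + \<epsilon> (t - \<tau>) u v\<^sup>T\<close>. Hence \<open>\<tau>\<close>
  and all elements of \<open>M\<close> are roots. A root other than \<open>\<tau>\<close> does not depend on \<open>\<tau>\<close>, by
  \<open>singular_rank_one_line\<close>, so a root outside \<open>M\<close> together with a new \<open>\<tau>\<close> would
  exceed the bound \<open>n\<close> on the number of roots. So for \<open>\<tau>\<close> in \<open>M\<close> there are only \<open>n - 1\<close> roots, and for other
  \<open>\<tau>\<close> there are \<open>n\<close>.
\<close>
lemma frontier_if_many_nodes:
  fixes A B :: "real^'n^'n"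
  assumes n: "2 \<le> CARD('n)"
    and sing: "\<And>t. det (B - t *\<^sub>R A) = 0"
    and M: "finite M" "CARD('n) \<le> Suc (card M)"
      "\<And>t c. t \<in> M \<Longrightarrow> det (B - t *\<^sub>R A + c *\<^sub>R rank1 u v) = 0"
    and inv: "\<And>\<epsilon>. \<epsilon> \<noteq> 0 \<Longrightarrow> invertible (A - \<epsilon> *\<^sub>R rank1 u v)"
  shows "pencil A B \<in> frontier (rank_le_set CARD('n))"
proof -
  define A' where "A' \<epsilon> = A - \<epsilon> *\<^sub>R rank1 u v" for \<epsilon>
  define B' where "B' \<tau> \<epsilon> = B - (\<epsilon> * \<tau>) *\<^sub>R rank1 u v" for \<epsilon> \<tau>
  define R where "R \<tau> \<epsilon> = {t. det (B' \<tau> \<epsilon> - t *\<^sub>R A' \<epsilon>) = 0}" for \<tau> \<epsilon>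
  have line: "B' \<tau> \<epsilon> - t *\<^sub>R A' \<epsilon> = B - t *\<^sub>R A + (\<epsilon> * (t - \<tau>)) *\<^sub>R rank1 u v" for \<tau> \<epsilon> t
    by (simp add: A'_def B'_def algebra_simps)
  have sub: "insert \<tau> M \<subseteq> R \<tau> \<epsilon>" for \<tau> \<epsilon>
    using sing M(3) by (auto simp: R_def line)
  have finR: "finite (R \<tau> \<epsilon>)" and cardR: "card (R \<tau> \<epsilon>) \<le> CARD('n)" if "\<epsilon> \<noteq> 0" for \<tau> \<epsilon>
  proof -
    have inv': "invertible (A' \<epsilon>)" using inv[OF that] by (simp add: A'_def)
    show "finite (R \<tau> \<epsilon>)" unfolding R_def by (rule finite_pencil_roots[OF inv'])
    then show "card (R \<tau> \<epsilon>) \<le> CARD('n)"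
      by (rule card_pencil_roots_le[OF inv']) (simp add: R_def)
  qed
  have fresh: "\<exists>\<tau>::real. \<tau> \<notin> F" if "finite F" for F
    using that ex_new_if_finite infinite_UNIV_char_0 by blast
  obtain \<tau>0 where \<tau>0: "\<tau>0 \<notin> M" using fresh M(1) by blast
  have cardM: "Suc (card M) = CARD('n)"
  proof -
    have "card (insert \<tau>0 M) \<le> card (R \<tau>0 1)" by (rule card_mono[OF finR sub]) simp
    also have "\<dots> \<le> CARD('n)" by (rule cardR) simp
    finally show ?thesis using M(1,2) \<tau>0 by simp
  qed
  have cont: "continuous_on UNIV (\<lambda>\<epsilon>. pencil (A' \<epsilon>) (B' \<tau> \<epsilon>))" for \<tau>
    unfolding A'_def B'_def by (intro continuous_intros)
  have at0: "pencil (A' 0) (B' \<tau> 0) = pencil A B" for \<tau> by (simp add: A'_def B'_def)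
  have "pencil A B \<in> closure (rank_le_set CARD('n))"
  proof -
    have "pencil (A' \<epsilon>) (B' \<tau>0 \<epsilon>) \<in> rank_le_set CARD('n)" if "0 < \<epsilon>" for \<epsilon>
    proof (rule distinct_roots_imp_rank_le)
      show "invertible (A' \<epsilon>)" using that inv by (simp add: A'_def)
      show "finite (insert \<tau>0 M)" "CARD('n) \<le> card (insert \<tau>0 M)" using M(1) \<tau>0 cardM by simp_all
    qed (use sub[of \<tau>0 \<epsilon>] in \<open>auto simp: R_def\<close>)
    then have "\<forall>\<^sub>F \<epsilon> in at_right 0. pencil (A' \<epsilon>) (B' \<tau>0 \<epsilon>) \<in> closure (rank_le_set CARD('n))"
      using closure_subset by (intro eventually_at_rightI[of 0 1]) auto
    from closed_perturbation_limit[OF cont closed_closure this] show ?thesis by (simp add: at0)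
  qed
  moreover have "pencil A B \<in> - interior (rank_le_set CARD('n))"
  proof -
    have "M \<noteq> {}" using cardM n by auto
    then obtain \<tau> where \<tau>: "\<tau> \<in> M" by blast
    have "card (R \<tau> \<epsilon>) < CARD('n)" if "0 < \<epsilon>" for \<epsilon>
    proof (rule ccontr)
      assume "\<not> card (R \<tau> \<epsilon>) < CARD('n)"
      then have "\<not> R \<tau> \<epsilon> \<subseteq> M" using card_mono[OF M(1), of "R \<tau> \<epsilon>"] cardM by linarith
      then obtain t where t: "t \<in> R \<tau> \<epsilon>" "t \<notin> M" by blast
      then have "t \<noteq> \<tau>" using \<tau> by blast
      obtain \<sigma> where \<sigma>: "\<sigma> \<notin> insert t M" using fresh[of "insert t M"] M(1) by blast
      have 1: "det (B - t *\<^sub>R A + (\<epsilon> * (t - \<tau>)) *\<^sub>R rank1 u v) = 0" using t(1) by (simp add: R_def line)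
      have 2: "\<epsilon> * (t - \<tau>) \<noteq> 0" using \<open>t \<noteq> \<tau>\<close> that by simp
      have "t \<in> R \<sigma> \<epsilon>"
        unfolding R_def line mem_Collect_eq by (rule singular_rank_one_line[OF sing 1 2])
      then have "insert \<sigma> (insert t M) \<subseteq> R \<sigma> \<epsilon>" using sub[of \<sigma> \<epsilon>] by blast
      moreover have "\<epsilon> \<noteq> 0" using that by simp
      ultimately have "card (insert \<sigma> (insert t M)) \<le> CARD('n)"
        by (intro order_trans[OF card_mono[OF finR] cardR[of \<epsilon> \<sigma>]])
      then show False using \<sigma> t(2) M(1) cardM by simp
    qed
    then have "pencil (A' \<epsilon>) (B' \<tau> \<epsilon>) \<in> - interior (rank_le_set CARD('n))" if "0 < \<epsilon>" for \<epsilon>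
      using repeated_root_imp_not_interior[of "A' \<epsilon>" "B' \<tau> \<epsilon>"] inv[of \<epsilon>] that
      by (simp add: A'_def R_def)
    then have "\<forall>\<^sub>F \<epsilon> in at_right 0. pencil (A' \<epsilon>) (B' \<tau> \<epsilon>) \<in> - interior (rank_le_set CARD('n))"
      by (intro eventually_at_rightI[of 0 1]) auto
    moreover have "closed (- interior (rank_le_set CARD('n) :: (real^2^'n^'n) set))" by (simp add: closed_Compl)
    ultimately have "pencil (A' 0) (B' \<tau> 0) \<in> - interior (rank_le_set CARD('n))"
      using closed_perturbation_limit[OF cont] by blast
    then show ?thesis by (simp add: at0)
  qed
  ultimately show ?thesis by (simp add: frontier_def)
qed

text \<open>
  For small \<open>s\<close> the matrix \<open>I - s P\<close> is invertible, so a null vector of the pencil at the parameter \<open>1 / s\<close>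
  cannot be orthogonal to \<open>a\<close>. Scaled to \<open>a \<bullet> x = 1\<close>, it solves \<open>x = a + s P x\<close>.
\<close>
lemma singular_pencil_null_vectors:
  fixes P :: "real^'n^'n"
  assumes a: "a \<bullet> a = 1" and sing: "\<And>t. det (P - t *\<^sub>R (mat 1 - rank1 a a)) = 0"
  obtains \<delta> x where "0 < \<delta>"
    "\<forall>s. 0 < s \<and> s < \<delta> \<longrightarrow> a \<bullet> x s = 1 \<and> x s = a + s *\<^sub>R (P *v x s)"
proof -
  have "continuous_on UNIV (\<lambda>s. det (mat 1 - s *\<^sub>R P))" by (intro continuous_intros)
  then have "\<forall>\<^sub>F s in at_right 0. det (mat 1 - s *\<^sub>R P) \<in> - {0}"
    by (rule open_meets_perturbation) auto
  then obtain \<delta> where \<delta>: "0 < \<delta>" "\<And>s. 0 < s \<Longrightarrow> s < \<delta> \<Longrightarrow> det (mat 1 - s *\<^sub>R P) \<noteq> 0"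
    unfolding eventually_at_right_field by auto
  have "\<exists>x. a \<bullet> x = 1 \<and> x = a + s *\<^sub>R (P *v x)" if s: "0 < s" "s < \<delta>" for s
  proof -
    obtain z where z: "z \<noteq> 0" "(P - (1 / s) *\<^sub>R (mat 1 - rank1 a a)) *v z = 0"
      using sing det_eq_0_iff_kernel by blast
    then have "s *\<^sub>R (P *v z) - (z - (a \<bullet> z) *\<^sub>R a) = s *\<^sub>R 0"
      using s unfolding z(2)[symmetric] pencil_mult_vec
      by (simp add: matrix_vector_mult_diff_rdistrib scaleR_right_diff_distrib)
    then have eq: "z = (a \<bullet> z) *\<^sub>R a + s *\<^sub>R (P *v z)" by (simp add: algebra_simps)
    have "a \<bullet> z \<noteq> 0"
    proof
      assume "a \<bullet> z = 0"
      then have "(mat 1 - s *\<^sub>R P) *v z = 0" using eq by (simp add: pencil_mult_vec)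
      then show False using \<delta>(2)[OF s] z(1) det_eq_0_iff_kernel by blast
    qed
    define x where "x = (1 / (a \<bullet> z)) *\<^sub>R z"
    have ax: "a \<bullet> x = 1" using \<open>a \<bullet> z \<noteq> 0\<close> by (simp add: x_def)
    have "x = (1 / (a \<bullet> z)) *\<^sub>R ((a \<bullet> z) *\<^sub>R a + s *\<^sub>R (P *v z))"
      unfolding x_def by (subst eq[symmetric]) (rule refl)
    moreover have "P *v x = (1 / (a \<bullet> z)) *\<^sub>R (P *v z)" by (simp add: x_def matrix_vector_mult_scaleR)
    ultimately have "x = a + s *\<^sub>R (P *v x)"
      using \<open>a \<bullet> z \<noteq> 0\<close> by (simp add: scaleR_right_distrib)
    then show ?thesis using ax by blast
  qed
  then have "\<forall>s. \<exists>x. 0 < s \<and> s < \<delta> \<longrightarrow> a \<bullet> x = 1 \<and> x = a + s *\<^sub>R (P *v x)" by blast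
  from choice[OF this] obtain x
    where "\<forall>s. 0 < s \<and> s < \<delta> \<longrightarrow> a \<bullet> x s = 1 \<and> x s = a + s *\<^sub>R (P *v x s)" by blast
  then show ?thesis using that \<delta>(1) by blast
qed

text \<open>
  Let \<open>x s\<close> and \<open>y s\<close> be the right and left null vectors at the parameter \<open>1 / s\<close>. If the span of the
  \<open>x s\<close> and the left Krylov space have dimensions adding up to \<open>n + 1\<close> or more, then \<open>independent_nodes\<close>
  provides the nodes for \<open>frontier_if_many_nodes\<close>; the \<open>+ 1\<close> accounts for \<open>a\<close>, which lies in both spaces.
  Otherwise some \<open>z \<noteq> 0\<close> is orthogonal to both. Perturbing \<open>P\<close> by \<open>\<epsilon> w z\<^sup>T\<close> keeps all the \<open>x s\<close> as null
  vectors, so the pencil stays singular. Choosing \<open>w\<close> so that only the last independent left Krylov vector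
  sees it, the next one is shifted by \<open>\<epsilon> z\<close>, and the left Krylov space grows. This is the induction
  step, since the frontier is closed.
\<close>
lemma projection_pencil_frontier:
  fixes P :: "real^'n^'n"
  assumes n: "2 \<le> CARD('n)" and a: "a \<bullet> a = 1"
    and "\<And>t. det (P - t *\<^sub>R (mat 1 - rank1 a a)) = 0"
  shows "pencil (mat 1 - rank1 a a) P \<in> frontier (rank_le_set CARD('n))"
  using assms(3)
proof (induction "CARD('n) - dim (range (\<lambda>j. ((*v) (transpose P) ^^ j) a))" arbitrary: P rule: less_induct)
  case less
  note sing = less.prems
  define c where "c = (\<lambda>j. ((*v) (transpose P) ^^ j) a)"
  have "a \<noteq> 0" using a by auto
  define E where "E = mat 1 - rank1 a a"
  have Ex: "E *v x = x - (a \<bullet> x) *\<^sub>R a" and xE: "x v* E = x - (a \<bullet> x) *\<^sub>R a" for x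
    by (simp_all add: E_def matrix_vector_mult_diff_rdistrib vector_matrix_mult_diff_rdistrib inner_commute)
  have sing': "det (transpose P - t *\<^sub>R (mat 1 - rank1 a a)) = 0" for t
  proof -
    have "transpose P - t *\<^sub>R (mat 1 - rank1 a a) = transpose (P - t *\<^sub>R (mat 1 - rank1 a a))"
      by (simp add: transpose_def vec_eq_iff mat_def rank1_def)
    then show ?thesis using sing by simp
  qed
  obtain \<delta>1 x where \<delta>1: "0 < \<delta>1"
    "\<forall>s. 0 < s \<and> s < \<delta>1 \<longrightarrow> a \<bullet> x s = 1 \<and> x s = a + s *\<^sub>R (P *v x s)"
    by (rule singular_pencil_null_vectors[OF a sing])
  obtain \<delta>2 y where \<delta>2: "0 < \<delta>2"
    "\<forall>s. 0 < s \<and> s < \<delta>2 \<longrightarrow> a \<bullet> y s = 1 \<and> y s = a + s *\<^sub>R (transpose P *v y s)"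
    by (rule singular_pencil_null_vectors[OF a sing'])
  let ?X = "x ` {0<..<\<delta>1}"
  have null_x: "(P - (1 / s) *\<^sub>R E) *v x s = 0" if "0 < s" "s < \<delta>1" for s
  proof -
    have "x s - a = s *\<^sub>R (P *v x s)" "a \<bullet> x s = 1" using \<delta>1(2) that by (metis add_diff_cancel_left')+
    then show ?thesis using that by (simp add: pencil_mult_vec Ex)
  qed
  have null_y: "y s v* (P - (1 / s) *\<^sub>R E) = 0" if "0 < s" "s < \<delta>2" for s
  proof -
    have "y s - a = s *\<^sub>R (y s v* P)" "a \<bullet> y s = 1"
      using \<delta>2(2) that by (metis add_diff_cancel_left' transpose_matrix_vector)+
    then have "y s v* E = s *\<^sub>R (y s v* P)" by (simp add: xE)
    moreover have "y s v* ((1 / s) *\<^sub>R E) = (1 / s) *\<^sub>R (y s v* E)"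
      by (simp add: vector_matrix_mult_def vec_eq_iff sum_distrib_left mult_ac)
    ultimately show ?thesis using that by (simp add: vector_matrix_mult_diff_rdistrib)
  qed
  show ?case
  proof (cases "CARD('n) + 1 \<le> dim ?X + dim (range c)")
    case True
    obtain S v where S: "finite S" "S \<subseteq> {0<..<\<delta>1}" "dim ?X \<le> Suc (card S)"
      "\<forall>s\<in>S. v \<bullet> x s = 0" "v \<bullet> a = 1"
      by (rule independent_nodes[OF \<open>a \<noteq> 0\<close> order_refl])
    \<comment> \<open>the nodes of \<open>y\<close> are taken below those of \<open>x\<close>, so that all nodes are distinct\<close>
    define \<delta> where "\<delta> = Min (insert \<delta>2 S)"
    have "\<delta> \<in> insert \<delta>2 S" unfolding \<delta>_def using S(1) by (intro Min_in) auto
    then have \<delta>: "0 < \<delta>" "\<delta> \<le> \<delta>2" "\<And>s. s \<in> S \<Longrightarrow> \<delta> \<le> s"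
      using \<delta>2(1) S(1,2) by (auto simp: \<delta>_def)
    have "range c \<subseteq> span (y ` {0<..<\<delta>})"
    proof -
      have "c j \<in> span (y ` {0<..<\<delta>})" for j
        unfolding c_def by (rule krylov_span_subset[OF \<delta>(1)]) (use \<delta>2(2) \<delta>(2) in auto)
      then show ?thesis by blast
    qed
    then have "dim (range c) \<le> dim (y ` {0<..<\<delta>})" by (metis dim_span dim_subset)
    from independent_nodes[OF \<open>a \<noteq> 0\<close> this]
    obtain T u where T: "finite T" "T \<subseteq> {0<..<\<delta>}" "dim (range c) \<le> Suc (card T)"
      "\<forall>s\<in>T. u \<bullet> y s = 0" "u \<bullet> a = 1" by metis
    have "S \<inter> T = {}" using \<delta>(3) T(2) by fastforce
    then have card: "card (S \<union> T) = card S + card T" using S(1) T(1) by (rule card_Un_disjoint[rotated 2])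
    have pos: "s > 0" if "s \<in> S \<union> T" for s using that S(2) T(2) by auto
    define M where "M = (\<lambda>s. 1 / s) ` (S \<union> T)"
    have "card M = card S + card T" unfolding M_def
      by (subst card_image) (auto simp: inj_on_def card)
    show ?thesis unfolding E_def[symmetric]
    proof (rule frontier_if_many_nodes[OF n, where M = M])
      show "det (P - t *\<^sub>R E) = 0" for t using sing by (simp add: E_def)
      show "finite M" using S(1) T(1) by (simp add: M_def)
      show "CARD('n) \<le> Suc (card M)" using True S(3) T(3) \<open>card M = _\<close> by linarith
      show "invertible (E - \<epsilon> *\<^sub>R rank1 u v)" if "\<epsilon> \<noteq> 0" for \<epsilon>
      proof (rule invertibleI_kernel)
        fix z assume "(E - \<epsilon> *\<^sub>R rank1 u v) *v z = 0"
        then have eq: "z - (a \<bullet> z) *\<^sub>R a = (\<epsilon> * (v \<bullet> z)) *\<^sub>R u"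
          by (simp add: pencil_mult_vec Ex)
        have "a \<bullet> (z - (a \<bullet> z) *\<^sub>R a) = 0" using a by (simp add: inner_diff_right)
        then have "\<epsilon> * (v \<bullet> z) = 0" unfolding eq using T(5) by (simp add: inner_commute)
        then have "v \<bullet> z = 0" using that by simp
        with eq have z: "z = (a \<bullet> z) *\<^sub>R a" by simp
        have "v \<bullet> z = (a \<bullet> z) * (v \<bullet> a)" by (subst z) simp
        then show "z = 0" using z S(5) \<open>v \<bullet> z = 0\<close> by simp
      qed
      show "det (P - t *\<^sub>R E + k *\<^sub>R rank1 u v) = 0" if t: "t \<in> M" for t k
      proof -
        obtain s where s: "t = 1 / s" "s \<in> S \<union> T" using t by (auto simp: M_def)
        show ?thesis
        proof (cases "s \<in> S")
          case True
          then have s': "0 < s" "s < \<delta>1" using S(2) by auto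
          have "(P - t *\<^sub>R E + k *\<^sub>R rank1 u v) *v x s = 0"
            using null_x[OF s'] S(4) True by (simp add: matrix_vector_mult_add_rdistrib scaleR_rank1 s(1))
          moreover have "x s \<noteq> 0" using \<delta>1(2) s' by fastforce
          ultimately show ?thesis using det_eq_0_iff_kernel by blast
        next
          case False
          then have s': "0 < s" "s < \<delta>2" "s \<in> T" using s T(2) \<delta>(2) by auto
          have "y s v* (P - t *\<^sub>R E + k *\<^sub>R rank1 u v) = 0"
            using null_y[OF s'(1,2)] T(4) s'(3)
            by (simp add: vector_matrix_mult_add_rdistrib scaleR_rank1 s(1) inner_commute)
          moreover have "y s \<noteq> 0" using \<delta>2(2) s' by fastforce
          ultimately show ?thesis using det_eq_0_iff_left_kernel by blast
        qed
      qed
    qed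
  next
    case False
    have "a \<in> span ?X"
      using krylov_span_subset[OF \<delta>1(1), of x a P 0] \<delta>1(2) by auto
    moreover have "a \<in> span (range c)"
      by (rule span_base) (auto simp: c_def intro: image_eqI[of _ _ 0])
    ultimately have "span {a} \<subseteq> span ?X \<inter> span (range c)"
      by (intro span_minimal) (auto intro: subspace_inter)
    then have "dim {a} \<le> dim (span ?X \<inter> span (range c))" by (metis dim_span dim_subset)
    then have "1 \<le> dim (span ?X \<inter> span (range c))" using \<open>a \<noteq> 0\<close> by simp
    moreover have "dim {p + q |p q. p \<in> span ?X \<and> q \<in> span (range c)} + dim (span ?X \<inter> span (range c))
        = dim ?X + dim (range c)"
      using dim_sums_Int[OF subspace_span subspace_span, of ?X "range c"] by simp
    ultimately have "dim {p + q |p q. p \<in> span ?X \<and> q \<in> span (range c)} < CARD('n)"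
      using False by linarith
    then obtain z where z: "z \<noteq> 0"
      "\<And>w. w \<in> span {p + q |p q. p \<in> span ?X \<and> q \<in> span (range c)} \<Longrightarrow> orthogonal z w"
      using orthogonal_to_subspace_exists[of "{p + q |p q. p \<in> span ?X \<and> q \<in> span (range c)}"] by auto
    have zX: "z \<bullet> w = 0" if w: "w \<in> span ?X" for w
    proof -
      have "w + 0 \<in> {p + q |p q. p \<in> span ?X \<and> q \<in> span (range c)}" using w span_zero by blast
      from z(2)[OF span_base[OF this]] show ?thesis by (simp add: orthogonal_def)
    qed
    have zL: "z \<bullet> w = 0" if w: "w \<in> span (range c)" for w
    proof -
      have "0 + w \<in> {p + q |p q. p \<in> span ?X \<and> q \<in> span (range c)}" using w span_zero by blast
      from z(2)[OF span_base[OF this]] show ?thesis by (simp add: orthogonal_def)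
    qed
    obtain j where j: "c (Suc j) \<in> span (c ` {..j})" "c j \<notin> span (c ` {..<j})"
      unfolding c_def by (rule krylov_first_dependence[OF \<open>a \<noteq> 0\<close>])
    obtain w where w: "\<forall>q\<in>span (c ` {..<j}). w \<bullet> q = 0" "w \<bullet> c j = 1"
      using separating_vector[OF j(2)] by blast
    define P' where "P' \<epsilon> = P + \<epsilon> *\<^sub>R rank1 w z" for \<epsilon>
    have "pencil E (P' \<epsilon>) \<in> frontier (rank_le_set CARD('n))" if \<epsilon>: "0 < \<epsilon>" for \<epsilon>
      unfolding E_def
    proof (rule less.hyps)
      define c' where "c' = (\<lambda>j. ((*v) (transpose (P' \<epsilon>)) ^^ j) a)"
      have c'_Suc: "c' (Suc i) = c' i v* P + (\<epsilon> * (c' i \<bullet> w)) *\<^sub>R z" for i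
        by (simp add: c'_def P'_def vector_matrix_mult_add_rdistrib scaleR_rank1)
      have c_Suc: "c (Suc i) = c i v* P" for i by (simp add: c_def)
      have same: "c' i = c i" if "i \<le> j" for i
        using that
      proof (induction i)
        case 0
        show ?case by (simp add: c_def c'_def)
      next
        case (Suc i)
        then have "c i \<in> span (c ` {..<j})" by (intro span_base imageI) simp
        then have "w \<bullet> c i = 0" using w(1) by blast
        then have "c i \<bullet> w = 0" by (simp add: inner_commute)
        then show ?case using Suc by (simp add: c'_Suc c_Suc)
      qed
      have "c ` {..j} \<subseteq> range c'"
      proof
        fix q assume "q \<in> c ` {..j}"
        then obtain i where "i \<le> j" "q = c i" by auto
        then have "q = c' i" using same by simp
        then show "q \<in> range c'" by simp
      qed
      moreover have stable: "c m \<in> span (c ` {..j})" for m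
        using krylov_span_stable[where P = "transpose P" and a = a and j = j and m = m] j(1)
        unfolding c_def by blast
      ultimately have sub: "span (range c) \<subseteq> span (range c')"
        by (metis (no_types, lifting) image_subset_iff span_mono span_minimal subset_trans subspace_span)
      have "c' (Suc j) = c (Suc j) + \<epsilon> *\<^sub>R z"
        using w(2) by (simp add: c'_Suc c_Suc same inner_commute)
      moreover have "c' (Suc j) - c (Suc j) \<in> span (range c')"
      proof (rule span_diff)
        show "c (Suc j) \<in> span (range c')" using sub span_base[of "c (Suc j)" "range c"] by blast
      qed (simp add: span_base)
      ultimately have "\<epsilon> *\<^sub>R z \<in> span (range c')" by simp
      from span_scale[OF this, of "1 / \<epsilon>"] have "z \<in> span (range c')" using \<epsilon> by simp
      moreover have "z \<notin> span (range c)" using zL[of z] z(1) by auto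
      ultimately have "span (range c) \<subset> span (range c')" using sub by blast
      then have "dim (range c) < dim (range c')" by (rule dim_psubset)
      moreover have "dim (range c') \<le> CARD('n)" by (rule dim_subset_UNIV_cart)
      ultimately show "CARD('n) - dim (range (\<lambda>j. ((*v) (transpose (P' \<epsilon>)) ^^ j) a))
          < CARD('n) - dim (range (\<lambda>j. ((*v) (transpose P) ^^ j) a))"
        unfolding c_def[symmetric] c'_def[symmetric] by linarith
      \<comment> \<open>\<open>z\<close> is orthogonal to every \<open>x s\<close>, so these null vectors survive\<close>
      have "det (P' \<epsilon> + t *\<^sub>R (- E)) = 0" if t: "t \<in> {1 / \<delta>1<..}" for t
      proof -
        have "0 < 1 / \<delta>1" using \<delta>1(1) by simp
        then have "0 < t" using t by (meson greaterThan_iff less_trans)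
        then have s: "0 < 1 / t" "1 / t < \<delta>1" using t \<delta>1(1) by (simp_all add: field_simps)
        have "x (1 / t) \<in> ?X" using s by (intro imageI) simp
        then have "z \<bullet> x (1 / t) = 0" using zX span_base by blast
        then have "(P' \<epsilon> + t *\<^sub>R (- E)) *v x (1 / t) = (P - (1 / (1 / t)) *\<^sub>R E) *v x (1 / t)"
          by (simp add: P'_def matrix_vector_mult_add_rdistrib matrix_vector_mult_diff_rdistrib scaleR_rank1)
        also have "\<dots> = 0" by (rule null_x[OF s])
        finally have "(P' \<epsilon> + t *\<^sub>R (- E)) *v x (1 / t) = 0" .
        moreover have "x (1 / t) \<noteq> 0" using \<delta>1(2) s by fastforce
        ultimately show ?thesis using det_eq_0_iff_kernel by blast
      qed
      then have "det (P' \<epsilon> + t *\<^sub>R (- E)) = 0" for t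
        by (rule det_affine_eq_0[OF infinite_Ioi])
      then show "det (P' \<epsilon> - t *\<^sub>R (mat 1 - rank1 a a)) = 0" for t
        unfolding E_def[symmetric] by simp
    qed
    then have "\<forall>\<^sub>F \<epsilon> in at_right 0. pencil E (P' \<epsilon>) \<in> frontier (rank_le_set CARD('n))"
      by (intro eventually_at_rightI[of 0 1]) auto
    moreover have "continuous_on UNIV (\<lambda>\<epsilon>. pencil E (P' \<epsilon>))"
      unfolding P'_def by (intro continuous_intros)
    ultimately have "pencil E (P' 0) \<in> frontier (rank_le_set CARD('n))"
      using closed_perturbation_limit[where f = "\<lambda>\<epsilon>. pencil E (P' \<epsilon>)"] frontier_closed by blast
    then show ?thesis by (simp add: P'_def E_def)
  qed
qed

lemma dim_le_Suc_dim_Int_hyperplane: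
  fixes N :: "(real^'n) set"
  assumes "subspace N" "d \<noteq> 0"
  shows "dim N \<le> Suc (dim (N \<inter> {x. d \<bullet> x = 0}))"
proof -
  have "dim {p + q |p q. p \<in> N \<and> q \<in> {x. d \<bullet> x = 0}} + dim (N \<inter> {x. d \<bullet> x = 0})
      = dim N + dim {x. d \<bullet> x = 0}"
    by (rule dim_sums_Int[OF assms(1) subspace_hyperplane])
  moreover have "dim {p + q |p q. p \<in> N \<and> q \<in> {x. d \<bullet> x = 0}} \<le> CARD('n)"
    by (rule dim_subset_UNIV_cart)
  moreover have "dim {x. d \<bullet> x = 0} = CARD('n) - 1" using dim_hyperplane[OF assms(2)] by simp
  ultimately show ?thesis by linarith
qed

lemma subspace_kernel: "subspace {x. A *v x = 0}" for A :: "real^'n^'m"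
  using linear_subspace_kernel[OF matrix_vector_mul_linear[of A]] .

text \<open>
  If \<open>a\<close> spans the kernel of \<open>A\<close> and \<open>b\<close> is a left null vector, then \<open>F = A + b a\<^sup>T\<close> is invertible and maps
  \<open>a\<close> to \<open>b\<close>, whence \<open>F\<^sup>-\<^sup>1 A = I - a a\<^sup>T\<close>.
\<close>
lemma singular_pencil_kernel_line_frontier:
  fixes A B :: "real^'n^'n"
  assumes n: "2 \<le> CARD('n)" and sing: "\<And>t. det (B - t *\<^sub>R A) = 0" and ker: "dim {x. A *v x = 0} = 1"
  shows "pencil A B \<in> frontier (rank_le_set CARD('n))"
proof -
  obtain K where K: "K \<subseteq> {x. A *v x = 0}" "independent K" "{x. A *v x = 0} \<subseteq> span K" "card K = 1"
    using basis_exists[of "{x. A *v x = 0}"] ker by metis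
  then obtain k where "K = {k}" by (auto simp: card_1_singleton_iff)
  then have k: "k \<noteq> 0" "{x. A *v x = 0} = span {k}"
    using K span_minimal[OF K(1) subspace_kernel] by (auto simp: dependent_single)
  define a where "a = (1 / norm k) *\<^sub>R k"
  have a: "a \<bullet> a = 1" using k(1) by (simp add: a_def dot_square_norm power2_eq_square)
  have "k \<in> {x. A *v x = 0}" unfolding k(2) by (rule span_base) simp
  then have Aa: "A *v a = 0" by (simp add: a_def matrix_vector_mult_scaleR)
  have ker_a: "\<exists>r. x = r *\<^sub>R a" if "A *v x = 0" for x
  proof -
    have "x \<in> span {k}" using that k(2) by blast
    then obtain r where "x = r *\<^sub>R k" by (auto simp: span_singleton)
    then have "x = (r * norm k) *\<^sub>R a" using k(1) by (simp add: a_def)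
    then show ?thesis by blast
  qed
  have "a \<noteq> 0" using a by auto
  then have "det A = 0" using Aa det_eq_0_iff_kernel by blast
  then obtain b where b: "b \<noteq> 0" "b v* A = 0" using det_eq_0_iff_left_kernel by blast
  define F where "F = A + rank1 b a"
  have Fx: "F *v x = A *v x + (a \<bullet> x) *\<^sub>R b" for x by (simp add: F_def matrix_vector_mult_add_rdistrib)
  have F: "invertible F"
  proof (rule invertibleI_kernel)
    fix x assume x: "F *v x = 0"
    have "b \<bullet> (A *v x) = 0" using b(2) by (simp flip: dot_lmul_matrix)
    then have "(a \<bullet> x) * (b \<bullet> b) = 0" using arg_cong[OF x, of "\<lambda>y. b \<bullet> y"] by (simp add: Fx inner_add_right)
    then have "a \<bullet> x = 0" using b(1) by simp
    then have "A *v x = 0" using x by (simp add: Fx)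
    then obtain r where "x = r *\<^sub>R a" using ker_a by blast
    then show "x = 0" using \<open>a \<bullet> x = 0\<close> a by simp
  qed
  define G where "G = matrix_inv F"
  have G: "G ** F = mat 1" "F ** G = mat 1" using matrix_inv_inverse[OF F] by (simp_all add: G_def)
  have invG: "invertible G" using G by (auto simp: invertible_def)
  have "G *v b = G *v (F *v a)" using a Aa by (simp add: Fx)
  then have Gb: "G *v b = a" by (simp add: matrix_vector_mul_assoc G)
  have GA: "G ** A = mat 1 - rank1 a a"
    unfolding matrix_eq
  proof
    fix x
    have "A *v x = F *v x - (a \<bullet> x) *\<^sub>R b" by (simp add: Fx)
    then have "(G ** A) *v x = (G ** F) *v x - (a \<bullet> x) *\<^sub>R (G *v b)"
      by (simp add: matrix_vector_mult_diff_distrib matrix_vector_mult_scaleR flip: matrix_vector_mul_assoc)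
    then show "(G ** A) *v x = (mat 1 - rank1 a a) *v x"
      by (simp add: G Gb matrix_vector_mult_diff_rdistrib)
  qed
  have "det (G ** B - t *\<^sub>R (mat 1 - rank1 a a)) = 0" for t
  proof -
    have "G ** B - t *\<^sub>R (mat 1 - rank1 a a) = G ** (B - t *\<^sub>R A)"
      unfolding GA[symmetric] matrix_eq
      by (simp add: pencil_mult_vec matrix_vector_mult_diff_distrib matrix_vector_mult_scaleR flip: matrix_vector_mul_assoc)
    then show ?thesis by (simp add: det_mul sing)
  qed
  then have "pencil (G ** A) (G ** B) \<in> frontier (rank_le_set CARD('n))"
    unfolding GA by (rule projection_pencil_frontier[OF n a])
  moreover have "invertible (mat 1 :: real^'n^'n)" by (simp add: invertible_det_nz)
  ultimately show ?thesis
    using strict_equivalence_iff[OF invG, of "mat 1" A B] by (simp add: frontier_def)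
qed

text \<open>
  Nullity \<open>k + 1\<close> is lowered by perturbing \<open>A\<close> by \<open>\<epsilon> b d\<^sup>T\<close> with a left null vector \<open>b\<close> and a null vector
  \<open>d\<close> of \<open>A\<close>: the kernel of \<open>A\<close> shrinks to its part orthogonal to \<open>d\<close>. The kernel of any combination of the
  slices loses at most one dimension, so as long as the minimal nullity exceeds one the pencil stays
  singular.
\<close>
lemma singular_pencil_frontier:
  fixes A B :: "real^'n^'n"
  assumes n: "2 \<le> CARD('n)"
    and "\<And>\<alpha> \<beta>. Suc k \<le> dim {x. (\<alpha> *\<^sub>R A + \<beta> *\<^sub>R B) *v x = 0}"
    and "dim {x. A *v x = 0} = Suc k"
  shows "pencil A B \<in> frontier (rank_le_set CARD('n))"
  using assms(2,3)
proof (induction k arbitrary: A)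
  case 0
  have "det (B - t *\<^sub>R A) = 0" for t
  proof -
    have eq: "(- t) *\<^sub>R A + 1 *\<^sub>R B = B - t *\<^sub>R A" by simp
    have "Suc 0 \<le> dim {x. (B - t *\<^sub>R A) *v x = 0}" using 0(1)[of "-t" 1] unfolding eq .
    then have "dim {x. (B - t *\<^sub>R A) *v x = 0} \<noteq> 0" by linarith
    then have "\<not> {x. (B - t *\<^sub>R A) *v x = 0} \<subseteq> {0}" unfolding dim_eq_0 .
    then show ?thesis using det_eq_0_iff_kernel by blast
  qed
  then show ?case using 0(2) by (intro singular_pencil_kernel_line_frontier[OF n]) simp_all
next
  case (Suc k)
  have "\<not> {x. A *v x = 0} \<subseteq> {0}" using Suc.prems(2) by (metis dim_eq_0 nat.distinct(1))
  then obtain d where d: "d \<noteq> 0" "A *v d = 0" by blast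
  then have "det A = 0" using det_eq_0_iff_kernel by blast
  then obtain b where b: "b \<noteq> 0" "b v* A = 0" using det_eq_0_iff_left_kernel by blast
  define A' where "A' \<epsilon> = A + \<epsilon> *\<^sub>R rank1 b d" for \<epsilon>
  have A'x: "A' \<epsilon> *v x = A *v x + (\<epsilon> * (d \<bullet> x)) *\<^sub>R b" for \<epsilon> x
    by (simp add: A'_def matrix_vector_mult_add_rdistrib scaleR_rank1)
  have "pencil (A' \<epsilon>) B \<in> frontier (rank_le_set CARD('n))" if \<epsilon>: "0 < \<epsilon>" for \<epsilon>
  proof (rule Suc.IH)
    show ge: "Suc k \<le> dim {x. (\<alpha> *\<^sub>R A' \<epsilon> + \<beta> *\<^sub>R B) *v x = 0}" for \<alpha> \<beta>
    proof -
      let ?N = "{x. (\<alpha> *\<^sub>R A + \<beta> *\<^sub>R B) *v x = 0}"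
      have "?N \<inter> {x. d \<bullet> x = 0} \<subseteq> {x. (\<alpha> *\<^sub>R A' \<epsilon> + \<beta> *\<^sub>R B) *v x = 0}"
        by (auto simp: matrix_vector_mult_add_rdistrib A'x simp flip: scaleR_matrix_vector_assoc)
      then have "dim (?N \<inter> {x. d \<bullet> x = 0}) \<le> dim {x. (\<alpha> *\<^sub>R A' \<epsilon> + \<beta> *\<^sub>R B) *v x = 0}"
        by (rule dim_subset)
      then show ?thesis
        using dim_le_Suc_dim_Int_hyperplane[OF subspace_kernel d(1), of "\<alpha> *\<^sub>R A + \<beta> *\<^sub>R B"]
          Suc.prems(1)[of \<alpha> \<beta>] by linarith
    qed
    have "{x. A' \<epsilon> *v x = 0} \<subset> {x. A *v x = 0}"
    proof
      show "{x. A' \<epsilon> *v x = 0} \<subseteq> {x. A *v x = 0}"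
      proof
        fix x assume "x \<in> {x. A' \<epsilon> *v x = 0}"
        then have eq: "A *v x + (\<epsilon> * (d \<bullet> x)) *\<^sub>R b = 0" by (simp add: A'x)
        have "b \<bullet> (A *v x) = 0" using b(2) by (simp flip: dot_lmul_matrix)
        then have "\<epsilon> * (d \<bullet> x) * (b \<bullet> b) = 0"
          using arg_cong[OF eq, of "\<lambda>y. b \<bullet> y"] by (simp add: inner_add_right)
        then have "\<epsilon> * (d \<bullet> x) = 0" using b(1) by simp
        then show "x \<in> {x. A *v x = 0}" using eq by auto
      qed
      have "d \<notin> {x. A' \<epsilon> *v x = 0}" using d b(1) \<epsilon> by (simp add: A'x)
      then show "{x. A' \<epsilon> *v x = 0} \<noteq> {x. A *v x = 0}" using d(2) by blast
    qed
    then have "dim {x. A' \<epsilon> *v x = 0} < dim {x. A *v x = 0}"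
      using subspace_kernel[of "A' \<epsilon>"] subspace_kernel[of A]
      by (intro dim_psubset) (simp add: span_eq_iff[THEN iffD2])
    then show "dim {x. A' \<epsilon> *v x = 0} = Suc k"
      using ge[of 1 0] Suc.prems(2) by simp
  qed
  then have "\<forall>\<^sub>F \<epsilon> in at_right 0. pencil (A' \<epsilon>) B \<in> frontier (rank_le_set CARD('n))"
    by (intro eventually_at_rightI[of 0 1]) auto
  moreover have "continuous_on UNIV (\<lambda>\<epsilon>. pencil (A' \<epsilon>) B)"
    unfolding A'_def by (intro continuous_intros)
  ultimately have "pencil (A' 0) B \<in> frontier (rank_le_set CARD('n))"
    using closed_perturbation_limit[where f = "\<lambda>\<epsilon>. pencil (A' \<epsilon>) B"] frontier_closed by blast
  then show ?case by (simp add: A'_def)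
qed

text \<open>
  A combination of the slices with least nullity is moved to the first slice by a rotation and scaling of
  the third mode.
\<close>
lemma frontier_if_all_combinations_singular:
  fixes Y :: "real^2^'n^'n"
  assumes n: "2 \<le> CARD('n)"
    and sing: "\<And>\<alpha> \<beta>. det (\<alpha> *\<^sub>R frontal_slice Y 1 + \<beta> *\<^sub>R frontal_slice Y 2) = 0"
  shows "Y \<in> frontier (rank_le_set CARD('n))"
proof -
  let ?A = "frontal_slice Y 1" and ?B = "frontal_slice Y 2"
  define f where "f \<alpha> \<beta> = dim {x. (\<alpha> *\<^sub>R ?A + \<beta> *\<^sub>R ?B) *v x = 0}" for \<alpha> \<beta> :: real
  define Q where "Q m \<longleftrightarrow> (\<exists>\<alpha> \<beta>. \<alpha>\<^sup>2 + \<beta>\<^sup>2 \<noteq> 0 \<and> f \<alpha> \<beta> = m)" for m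
  have "Q (f 1 0)" unfolding Q_def by (rule exI[of _ 1], rule exI[of _ 0]) simp
  then have "Q (LEAST m. Q m)" by (rule LeastI)
  then obtain \<alpha> \<beta> where ab: "\<alpha>\<^sup>2 + \<beta>\<^sup>2 \<noteq> 0" "f \<alpha> \<beta> = (LEAST m. Q m)" by (auto simp: Q_def)
  have min: "f \<alpha> \<beta> \<le> f \<gamma> \<delta>" for \<gamma> \<delta>
  proof (cases "\<gamma>\<^sup>2 + \<delta>\<^sup>2 = 0")
    case True
    then have "\<gamma> = 0" "\<delta> = 0" by (simp_all add: sum_power2_eq_zero_iff)
    then have "f \<gamma> \<delta> = CARD('n)" by (simp add: f_def)
    then show ?thesis unfolding f_def by (metis dim_subset_UNIV_cart)
  next
    case False
    then show ?thesis unfolding ab(2) by (intro Least_le) (auto simp: Q_def)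
  qed
  obtain k where k: "f \<alpha> \<beta> = Suc k"
  proof -
    have "\<not> {x. (\<alpha> *\<^sub>R ?A + \<beta> *\<^sub>R ?B) *v x = 0} \<subseteq> {0}"
      using sing[of \<alpha> \<beta>] unfolding det_eq_0_iff_kernel by blast
    then have "f \<alpha> \<beta> \<noteq> 0" by (simp add: f_def)
    then show thesis using that not0_implies_Suc by blast
  qed
  define U :: "real^2^2" where "U = (\<chi> i j. if i = 1 then (if j = 1 then \<alpha> else \<beta>) else (if j = 1 then - \<beta> else \<alpha>))"
  have U: "invertible U"
    using ab(1) by (simp add: invertible_det_nz det_2 U_def power2_eq_square)
  define A where "A = \<alpha> *\<^sub>R ?A + \<beta> *\<^sub>R ?B"
  define B where "B = (- \<beta>) *\<^sub>R ?A + \<alpha> *\<^sub>R ?B"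
  have mix: "multilinear_mult (mat 1) (mat 1) U Y = pencil A B"
    by (simp add: mix_slices_eq U_def A_def B_def)
  have "pencil A B \<in> frontier (rank_le_set CARD('n))"
  proof (rule singular_pencil_frontier[OF n])
    show "Suc k \<le> dim {x. (\<gamma> *\<^sub>R A + \<delta> *\<^sub>R B) *v x = 0}" for \<gamma> \<delta>
    proof -
      have "\<gamma> *\<^sub>R A + \<delta> *\<^sub>R B = (\<gamma> * \<alpha> - \<delta> * \<beta>) *\<^sub>R ?A + (\<gamma> * \<beta> + \<delta> * \<alpha>) *\<^sub>R ?B"
        by (simp add: A_def B_def algebra_simps)
      then show ?thesis using min[of "\<gamma> * \<alpha> - \<delta> * \<beta>" "\<gamma> * \<beta> + \<delta> * \<alpha>"] by (simp add: f_def k[symmetric])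
    qed
    show "dim {x. A *v x = 0} = Suc k" using k by (simp add: f_def A_def)
  qed
  then show ?thesis using slice_mixing_iff[OF U, of Y] by (simp add: mix frontier_def)
qed

section \<open>The trichotomy\<close>

lemma eigvals_quotient:
  fixes A B :: "real^'n^'n"
  assumes "invertible A"
  shows "eigvals (B ** matrix_inv A) = {t. det (B - t *\<^sub>R A) = 0}"
proof -
  let ?M = "B ** matrix_inv A"
  have "(?M - t *\<^sub>R mat 1) ** A = B - t *\<^sub>R A" for t
  proof -
    have "?M *v (A *v x) = B *v x" for x
      using matrix_inv_inverse[OF assms] by (metis matrix_mul_assoc matrix_mul_rid matrix_vector_mul_assoc)
    then show ?thesis
      unfolding matrix_eq by (simp add: pencil_mult_vec flip: matrix_vector_mul_assoc)
  qed
  then have "det (B - t *\<^sub>R A) = det (?M - t *\<^sub>R mat 1) * det A" for t by (metis det_mul)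
  then show ?thesis using assms by (simp add: eigvals_eq_roots invertible_det_nz)
qed

theorem proposition2p2:
  fixes Y :: "real^2^'n^'n"
  shows
    "(\<forall>U :: real^2^2.
        let X = multilinear_mult (mat 1) (mat 1) U Y :: real^2^'n^'n;
            X1 = frontal_slice X 1;
            X2 = frontal_slice X 2;
            A = X2 ** matrix_inv X1
        in invertible U \<and> invertible X1 \<longrightarrow>
           (card (eigvals A) = CARD('n) \<longrightarrow>
              Y \<in> interior (rank_le_set CARD('n))) \<and>
           ((\<Sum>c\<in>eigvals A. alg_mult A c) = CARD('n) \<and> card (eigvals A) < CARD('n) \<longrightarrow>
              Y \<in> frontier (rank_le_set CARD('n))) \<and>
           ((\<exists>c\<in>eigvals (complexify A). c \<notin> \<real>) \<longrightarrow>
              Y \<notin> closure (rank_le_set CARD('n))))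
     \<and>
     (CARD('n) \<ge> 2 \<and>
      \<not> (\<exists>U :: real^2^2. invertible U \<and>
            invertible (frontal_slice (multilinear_mult (mat 1) (mat 1) U Y :: real^2^'n^'n) 1)) \<longrightarrow>
      Y \<in> frontier (rank_le_set CARD('n)))"
proof (intro conjI allI impI)
  fix U :: "real^2^2"
  define X where "X = (multilinear_mult (mat 1) (mat 1) U Y :: real^2^'n^'n)"
  define X1 where "X1 = frontal_slice X 1"
  define X2 where "X2 = frontal_slice X 2"
  define A where "A = X2 ** matrix_inv X1"
  have X: "X = pencil X1 X2" by (simp add: X1_def X2_def pencil_frontal_slices)
  have "(card (eigvals A) = CARD('n) \<longrightarrow> Y \<in> interior (rank_le_set CARD('n))) \<and>
     ((\<Sum>c\<in>eigvals A. alg_mult A c) = CARD('n) \<and> card (eigvals A) < CARD('n) \<longrightarrow>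
        Y \<in> frontier (rank_le_set CARD('n))) \<and>
     ((\<exists>c\<in>eigvals (complexify A). c \<notin> \<real>) \<longrightarrow> Y \<notin> closure (rank_le_set CARD('n)))"
    if U: "invertible U" and X1: "invertible X1"
  proof (intro conjI impI)
    note to_X = slice_mixing_iff[OF U, of Y, folded X_def, unfolded X, symmetric]
    have eig: "eigvals A = {t. det (X2 - t *\<^sub>R X1) = 0}"
      unfolding A_def by (rule eigvals_quotient[OF X1])
    {
      assume card: "card (eigvals A) = CARD('n)"
      then have "finite (eigvals A)" using card_ge_0_finite[of "eigvals A"] by simp
      then obtain \<mu> :: "'n \<Rightarrow> real" where "inj \<mu>" "range \<mu> \<subseteq> eigvals A"
        by (rule inj_enumeration[where 'n = 'n]) (simp add: card)
      then show "Y \<in> interior (rank_le_set CARD('n))"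
        unfolding to_X(2) by (intro distinct_roots_imp_interior[OF X1]) (auto simp: eig)
    next
      assume *: "(\<Sum>c\<in>eigvals A. alg_mult A c) = CARD('n) \<and> card (eigvals A) < CARD('n)"
      have "pencil (mat 1) A \<in> closure (rank_le_set CARD('n))"
        by (rule splitting_char_polynomial_imp_closure) (use * in simp)
      moreover have "A ** X1 = X2"
        unfolding A_def by (metis X1 matrix_inv_inverse(2) matrix_mul_assoc matrix_mul_rid)
      moreover have "invertible (mat 1 :: real^'n^'n)" by (simp add: invertible_det_nz)
      ultimately have "pencil X1 X2 \<in> closure (rank_le_set CARD('n))"
        using strict_equivalence_iff(1)[of "mat 1" X1 "mat 1" A] X1 by simp
      moreover have "pencil X1 X2 \<notin> interior (rank_le_set CARD('n))"
        by (rule repeated_root_imp_not_interior[OF X1]) (use * in \<open>simp add: eig\<close>)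
      ultimately show "Y \<in> frontier (rank_le_set CARD('n))"
        unfolding frontier_def by (simp add: to_X)
    next
      assume "\<exists>c\<in>eigvals (complexify A). c \<notin> \<real>"
      then obtain c where "c \<in> eigvals (complexify A)" "c \<notin> \<real>" by blast
      then show "Y \<notin> closure (rank_le_set CARD('n))"
        unfolding to_X A_def
        by (intro nonreal_root_imp_not_closure[OF X1 _ nonreal_eigenvalue_imp_root[OF X1]])
    }
  qed
  then show "let X = multilinear_mult (mat 1) (mat 1) U Y :: real^2^'n^'n;
            X1 = frontal_slice X 1;
            X2 = frontal_slice X 2;
            A = X2 ** matrix_inv X1
        in invertible U \<and> invertible X1 \<longrightarrow>
           (card (eigvals A) = CARD('n) \<longrightarrow>
              Y \<in> interior (rank_le_set CARD('n))) \<and>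
           ((\<Sum>c\<in>eigvals A. alg_mult A c) = CARD('n) \<and> card (eigvals A) < CARD('n) \<longrightarrow>
              Y \<in> frontier (rank_le_set CARD('n))) \<and>
           ((\<exists>c\<in>eigvals (complexify A). c \<notin> \<real>) \<longrightarrow>
              Y \<notin> closure (rank_le_set CARD('n)))"
    unfolding Let_def X_def[symmetric] X1_def[symmetric] X2_def[symmetric] A_def[symmetric] by blast
next
  assume *: "CARD('n) \<ge> 2 \<and>
      \<not> (\<exists>U :: real^2^2. invertible U \<and>
            invertible (frontal_slice (multilinear_mult (mat 1) (mat 1) U Y :: real^2^'n^'n) 1))"
  have "det (\<alpha> *\<^sub>R frontal_slice Y 1 + \<beta> *\<^sub>R frontal_slice Y 2) = 0" for \<alpha> \<beta>
  proof (cases "\<alpha>\<^sup>2 + \<beta>\<^sup>2 = 0")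
    case True
    then have "\<alpha> = 0" "\<beta> = 0" by (simp_all add: sum_power2_eq_zero_iff)
    then show ?thesis using det_0[where 'n = 'n and 'a = real] by (simp add: mat_0)
  next
    case False
    define U :: "real^2^2" where "U = (\<chi> i j. if i = 1 then (if j = 1 then \<alpha> else \<beta>) else (if j = 1 then - \<beta> else \<alpha>))"
    have "invertible U" using False by (simp add: invertible_det_nz det_2 U_def power2_eq_square)
    then have "\<not> invertible (frontal_slice (multilinear_mult (mat 1) (mat 1) U Y) 1)" using * by blast
    then show ?thesis by (simp add: frontal_slice_mode3_mult U_def invertible_det_nz)
  qed
  then show "Y \<in> frontier (rank_le_set CARD('n))"
    using * by (intro frontier_if_all_combinations_singular) auto
qed

end
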